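(* Let $n\ge1$, let $\lambda\in\mathcal{SP}_n$ and $\mu\in\mathcal{OP}_n$. The spin Green polynomials $Y^\lambda_\mu(t)$ satisfy: (1) $Y^{\lambda}_{\mu}(t)=\sum_{\nu\in\mathcal{SP}_n}L_{\nu\lambda}(t)\,Y^{\nu}_{\mu}(0)$. (2) $Y^{\lambda}_{\mu}(t)$ has degree $n(\lambda)$ in $t$ with leading coefficient $2^{l(\lambda)-1}$. (3) $Y^{\lambda}_{\mu}(0)=2^{\frac{l(\lambda)-l(\mu)+\epsilon(\lambda)}{2}}\,\zeta^{\lambda}_{\mu}$. (4) $Y^{(n)}_{\mu}(t)=1$. (5) If $(k,n-k)$ is a strict two-row partition of $n$ (i.e. $k>n-k\ge1$), then $$Y^{(k,n-k)}_{\mu}(t)=\frac{2(t-1)}{t+1}\Big([D_t(\mu)t^{-k}]_+-\big([D_t(\mu)t^{-k}]_+\big|_{t=-1}\big)\Big)+D^{(n-k)}(\mu).$$ (6) $$Y^{\lambda}_{\mu}(t)=\sum_{i=0}^{n-\lambda_1}\ \sum_{\nu\in\{\mu\}_i}\ \sum_{\rho\in\mathcal{OP}_{n-\lambda_1-i}}\frac{(-2)^{l(\rho)}}{z_{\rho}(t)}\,Y^{\lambda^{\hat{1}}}_{\nu\cup\rho}(t).$$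
   Context: $\mathcal{SP}_n$ (resp. $\mathcal{OP}_n$) is the set of partitions of $n$ with distinct parts (resp. with all parts odd); $l(\lambda)$ is the number of nonzero parts; $n(\lambda)=\sum_{i\ge1}(i-1)\lambda_i$; $\lambda^{\hat1}=(\lambda_2,\lambda_3,\dots)$; $\nu\cup\rho$ is the partition whose parts are those of $\nu$ and $\rho$ together. $z_\lambda=\prod_{i\ge1}i^{m_i(\lambda)}m_i(\lambda)!$, where $m_i(\lambda)$ is the multiplicity of $i$ in $\lambda$, and $z_\lambda(t)=z_\lambda\prod_{i=1}^{l(\lambda)}(1-t^{\lambda_i})^{-1}$. For empty partitions, $l(\emptyset)=0$ and $z_\emptyset(t)=1$. Let $\Gamma=\mathbb{C}(t)[p_1,p_3,p_5,\dots]$ be the polynomial ring over $\mathbb{C}(t)$ in the odd power sums, with unit $\mathbbm{1}$ ("vacuum vector"), and $p_\mu=p_{\mu_1}p_{\mu_2}\cdots$. Define operators $Q_n,G_n$ ($n\in\mathbb Z$) on $\Gamma$ by $$Q(z)=\exp\Big(\sum_{n\ge1\text{ odd}}\tfrac{2}{n}p_nz^n\Big)\exp\Big(-\sum_{n\ge1\text{ odd}}\tfrac{\partial}{\partial p_n}z^{-n}\Big)=\sum_{n\in\mathbb Z}Q_nz^n,$$ $$G(z)=\exp\Big(\sum_{n\ge1\text{ odd}}\tfrac{2}{n}p_nz^n\Big)\exp\Big(\sum_{n\ge1\text{ odd}}(t^n-1)\tfrac{\partial}{\partial p_n}z^{-n}\Big)=\sum_{n\in\mathbb Z}G_nz^n.$$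 For strict $\lambda=(\lambda_1,\dots,\lambda_l)$, Schur's $Q$-function is $Q_\lambda=Q_{\lambda_1}\cdots Q_{\lambda_l}.\mathbbm{1}$, and the $Q$-Hall-Littlewood function is $G_\lambda(x;t)=G_{\lambda_1}\cdots G_{\lambda_l}.\mathbbm{1}$ (equivalently $\prod_{i<j}\frac{1+tR_{ij}}{1-tR_{ij}}Q_\lambda$ with raising operators $R_{ij}$); $G_\lambda(x;0)=Q_\lambda$. The $Q_\lambda$, $\lambda$ strict, form a basis of $\Gamma$. The $Q$-Kostka polynomials $L_{\nu\lambda}(t)$ are defined by $G_\lambda(x;t)=\sum_{\nu\text{ strict}}L_{\nu\lambda}(t)Q_\nu$. The spin Green polynomials $Y^\lambda_\mu(t)$ ($\lambda\in\mathcal{SP}_n$, $\mu\in\mathcal{OP}_n$) are defined by $$G_\lambda(x;t)=\sum_{\mu\in\mathcal{OP}_n}z_\mu^{-1}2^{l(\mu)}Y^\lambda_\mu(t)\,p_\mu$$ (for $n=0$, $Y^\emptyset_\emptyset=1$). $\zeta^\lambda_\mu$ denotes the value on the class indexed by $\mu\in\mathcal{OP}_n$ of the irreducible negative (spin) character of the double cover $\tilde{\mathfrak S}_n$ of the symmetric group indexed by $\lambda\in\mathcal{SP}_n$; it is determined by the Frobenius-type formula (Schur) $$Q_\lambda=\sum_{\mu\in\mathcal{OP}_n}z_\mu^{-1}2^{\frac{l(\lambda)+l(\mu)+\epsilon(\lambda)}{2}}\zeta^\lambda_\mu\,p_\mu,$$ where $\epsilon(\lambda)=0$ if $n-l(\lambda)$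 is even and $\epsilon(\lambda)=1$ otherwise. A subpartition $\nu\lhd\mu$ of $\mu=(\mu_1,\dots,\mu_l)$ is $\nu=(\mu_{i_1},\dots,\mu_{i_k})$ for an index set $1\le i_1<\dots<i_k\le l$ (including $\emptyset$ and $\mu$); $\{\mu\}_i$ is the collection of subpartitions of $\mu$ of weight $i$. Subpartitions are counted according to their index sets, i.e. different index sets giving the same $\nu$ count separately. $D^{(i)}(\mu)$ is the cardinality of $\{\mu\}_i$ and $D_t(\mu)=\sum_{i\ge0}D^{(i)}(\mu)t^i$ (so $D_t(\mu)=\prod_{i\ge1}(1+t^i)^{m_i(\mu)}$). For a Laurent polynomial $f(t)$, $[f(t)]_+$ is its regular part, i.e. the sum of the terms with nonnegative powers of $t$. *)

theory Defs
  imports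
    "HOL-Library.Poly_Mapping"
    "HOL-Library.Groups_Big_Fun"
    "HOL-Computational_Algebra.Polynomial_Factorial"
    "HOL-Computational_Algebra.Formal_Power_Series"
    "Jordan_Normal_Form.Matrix"
begin

section \<open>Partitions\<close>

text \<open>A partition is the weakly decreasing list of its (positive) parts; its weight is
  the sum of the list and its number of parts is the length of the list.\<close>

type_synonym partition = "nat list"

definition is_partition :: "partition \<Rightarrow> bool" where
  "is_partition xs \<longleftrightarrow> sorted_wrt (\<ge>) xs \<and> 0 \<notin> set xs"

definition is_strict :: "partition \<Rightarrow> bool" where
  "is_strict xs \<longleftrightarrow> is_partition xs \<and> distinct xs"

definition SP :: "nat \<Rightarrow> partition set" where
  "SP n = {xs. is_strict xs \<and> sum_list xs = n}"

definition OP :: "nat \<Rightarrow> partition set" where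
  "OP n = {xs. is_partition xs \<and> (\<forall>x\<in>set xs. odd x) \<and> sum_list xs = n}"

text \<open>List positions start at 0, so this is the sum of \<open>(i - 1) \<lambda>\<^sub>i\<close> over \<open>i \<ge> 1\<close>.\<close>

definition n_stat :: "partition \<Rightarrow> nat" where
  "n_stat xs = (\<Sum>i<length xs. i * xs ! i)"

definition part_union :: "partition \<Rightarrow> partition \<Rightarrow> partition" where
  "part_union xs ys = rev (sort (xs @ ys))"

definition z_stat :: "partition \<Rightarrow> nat" where
  "z_stat xs = (\<Prod>i\<in>set xs. i ^ count_list xs i * fact (count_list xs i))"

definition eps :: "partition \<Rightarrow> nat" where
  "eps xs = (if even (sum_list xs - length xs) then 0 else 1)"

text \<open>Subpartitions are counted by index sets: \<open>I\<close> stands for the subpartition \<open>nths xs I\<close>.\<close>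

definition sub_index_sets :: "partition \<Rightarrow> nat \<Rightarrow> nat set set" where
  "sub_index_sets xs i = {I. I \<subseteq> {..<length xs} \<and> sum_list (nths xs I) = i}"

definition D_num :: "partition \<Rightarrow> nat \<Rightarrow> nat" where
  "D_num xs i = card (sub_index_sets xs i)"

text \<open>No subpartition weighs more than \<open>xs\<close>, so the generating function stops at \<open>sum_list xs\<close>.\<close>

definition D_poly :: "partition \<Rightarrow> complex poly" where
  "D_poly xs = (\<Sum>i\<le>sum_list xs. monom (of_nat (D_num xs i)) i)"

text \<open>The regular part \<open>[t\<^sup>-\<^sup>k p(t)]\<^sub>+\<close>: \<open>poly_shift k\<close> drops the terms of degree below \<open>k\<close> and divides
  the rest by \<open>t\<^sup>k\<close>.\<close>

definition regular_part :: "nat \<Rightarrow> complex poly \<Rightarrow> complex poly" where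
  "regular_part k p = poly_shift k p"


section \<open>The field of rational functions and the ring \<open>\<Gamma>\<close>\<close>

type_synonym ratfun = "complex poly fract"

definition tvar :: ratfun where
  "tvar = to_fract [:0, 1:]"

definition const_ratfun :: "complex \<Rightarrow> ratfun" where
  "const_ratfun c = to_fract [:c:]"

text \<open>The value at \<open>a\<close> of a rational function that is regular at \<open>a\<close>.\<close>

definition ratfun_at :: "ratfun \<Rightarrow> complex \<Rightarrow> complex" where
  "ratfun_at f a =
    (THE c. \<exists>p q. poly q a \<noteq> 0 \<and> f = Fraction_Field.Fract p q \<and> c = poly p a / poly q a)"

definition z_stat_t :: "partition \<Rightarrow> ratfun" where
  "z_stat_t xs = of_nat (z_stat xs) * prod_list (map (\<lambda>i. inverse (1 - tvar ^ i)) xs)"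

text \<open>Polynomials in countably many indeterminates: exponent vectors are finitely supported
  functions, and the indeterminate with index \<open>k\<close> is the odd power sum \<open>p\<^bsub>2k+1\<^esub>\<close>.\<close>

type_synonym gamma = "(nat \<Rightarrow>\<^sub>0 nat) \<Rightarrow>\<^sub>0 ratfun"

definition scalar :: "ratfun \<Rightarrow> gamma" where
  "scalar c = Poly_Mapping.single 0 c"

text \<open>For odd \<open>n\<close>, \<open>psum n\<close> is the generator \<open>p\<^sub>n\<close> and \<open>dpsum n\<close> is the partial derivative
  with respect to \<open>p\<^sub>n\<close>; they are not used for even \<open>n\<close>.\<close>

definition psum :: "nat \<Rightarrow> gamma" where
  "psum n = Poly_Mapping.single (Poly_Mapping.single (n div 2) 1) 1"

definition dpsum :: "nat \<Rightarrow> gamma \<Rightarrow> gamma" where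
  "dpsum n f =
    (\<Sum>m\<in>Poly_Mapping.keys f.
       Poly_Mapping.single (m - Poly_Mapping.single (n div 2) 1)
         (of_nat (Poly_Mapping.lookup m (n div 2)) * Poly_Mapping.lookup f m))"

definition psum_part :: "partition \<Rightarrow> gamma" where
  "psum_part xs = prod_list (map psum xs)"


section \<open>Vertex operators\<close>

text \<open>The left factor, the exponential of \<open>A(z) = \<Sum> (2/n) p\<^sub>n z\<^sup>n\<close> (\<open>n\<close> odd): its coefficient of
  \<open>z\<^sup>m\<close>. As \<open>A(z)\<close> has no constant term, \<open>A(z)\<^sup>k\<close> contributes only for \<open>k \<le> m\<close>.\<close>

definition psum_series :: "gamma fps" where
  "psum_series = Abs_fps (\<lambda>n. if odd n then scalar (2 / of_nat n) * psum n else 0)"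

definition creation_coeff :: "nat \<Rightarrow> gamma" where
  "creation_coeff m =
    (\<Sum>k\<le>m. scalar (1 / of_nat (fact k)) * fps_nth (psum_series ^ k) m)"

text \<open>The right factor, the exponential of \<open>B(w) = \<Sum> c\<^sub>n (\<partial>/\<partial>p\<^sub>n) w\<^sup>n\<close> (\<open>n\<close> odd), \<open>w = z\<^sup>-\<^sup>1\<close>, applied
  to \<open>f\<close>: its coefficient of \<open>w\<^sup>m\<close>. Here \<open>B(w)\<close> acts on power series in \<open>w\<close> over \<open>\<Gamma>\<close>, and again
  only \<open>k \<le> m\<close> contributes.\<close>

definition deriv_series :: "(nat \<Rightarrow> ratfun) \<Rightarrow> gamma fps \<Rightarrow> gamma fps" where
  "deriv_series c F =
    Abs_fps (\<lambda>m. \<Sum>n\<in>{n. odd n \<and> n \<le> m}. scalar (c n) * dpsum n (fps_nth F (m - n)))"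

definition annihilation_coeff :: "(nat \<Rightarrow> ratfun) \<Rightarrow> nat \<Rightarrow> gamma \<Rightarrow> gamma" where
  "annihilation_coeff c m f =
    (\<Sum>k\<le>m. scalar (1 / of_nat (fact k)) * fps_nth ((deriv_series c ^^ k) (fps_const f)) m)"

text \<open>The coefficient of \<open>z\<^sup>n\<close> in the product of the two factors, applied to \<open>f\<close>. For each \<open>f\<close>
  only finitely many \<open>annihilation_coeff c m f\<close> are nonzero, so \<open>Sum_any\<close> is a genuine sum.\<close>

definition vertex_op :: "(nat \<Rightarrow> ratfun) \<Rightarrow> int \<Rightarrow> gamma \<Rightarrow> gamma" where
  "vertex_op c n f =
    Sum_any (\<lambda>m::nat. if n + int m \<ge> 0
                      then creation_coeff (nat (n + int m)) * annihilation_coeff c m f else 0)"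

definition Q_op :: "int \<Rightarrow> gamma \<Rightarrow> gamma" where
  "Q_op = vertex_op (\<lambda>n. - 1)"

definition G_op :: "int \<Rightarrow> gamma \<Rightarrow> gamma" where
  "G_op = vertex_op (\<lambda>n. tvar ^ n - 1)"

definition Q_fun :: "partition \<Rightarrow> gamma" where
  "Q_fun xs = foldr (\<lambda>k. Q_op (int k)) xs 1"

definition G_fun :: "partition \<Rightarrow> gamma" where
  "G_fun xs = foldr (\<lambda>k. G_op (int k)) xs 1"


section \<open>Q-Kostka polynomials and spin Green polynomials\<close>

text \<open>\<open>Q_Kostka \<nu> \<lambda>\<close> is the coefficient of \<open>Q_fun \<nu>\<close> in the expansion of \<open>G_fun \<lambda>\<close> in the basis
  of Schur's Q-functions.\<close>

definition Q_Kostka :: "partition \<Rightarrow> partition \<Rightarrow> ratfun" where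
  "Q_Kostka nu lam =
    (THE L. finite {xs. L xs \<noteq> 0} \<and> (\<forall>xs. L xs \<noteq> 0 \<longrightarrow> is_strict xs) \<and>
            G_fun lam = (\<Sum>xs\<in>{xs. L xs \<noteq> 0}. scalar (L xs) * Q_fun xs)) nu"

text \<open>\<open>spin_Green \<lambda> \<mu>\<close> is \<open>Y\<^sup>\<lambda>\<^sub>\<mu>(t)\<close> for \<open>\<lambda>\<close> and \<open>\<mu>\<close> of equal weight; the value 0 outside
  \<open>OP n\<close> only makes the function unique.\<close>

definition spin_Green :: "partition \<Rightarrow> partition \<Rightarrow> ratfun" where
  "spin_Green lam =
    (THE Y. (\<forall>mu. mu \<notin> OP (sum_list lam) \<longrightarrow> Y mu = 0) \<and>
            G_fun lam =
              (\<Sum>mu\<in>OP (sum_list lam).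
                 scalar (inverse (of_nat (z_stat mu)) * 2 ^ length mu * Y mu) * psum_part mu))"


section \<open>Spin characters of the symmetric group\<close>

text \<open>The double cover of the symmetric group \<open>S\<^sub>n\<close> is generated by \<open>t\<^sub>1, \<dots>, t\<^bsub>n-1\<^esub>\<close> and a central
  element \<open>z\<close> with \<open>z\<^sup>2 = 1\<close>, subject to \<open>t\<^sub>i\<^sup>2 = z\<close>, \<open>t\<^sub>i t\<^bsub>i+1\<^esub> t\<^sub>i = t\<^bsub>i+1\<^esub> t\<^sub>i t\<^bsub>i+1\<^esub>\<close>, and
  \<open>t\<^sub>i t\<^sub>j = z t\<^sub>j t\<^sub>i\<close> for \<open>\<bar>i - j\<bar> > 1\<close>. A negative (spin) representation is one in which \<open>z\<close> acts
  as \<open>-1\<close>; it is given by the matrices \<open>T i\<close> of the generators \<open>t\<^sub>i\<close>.\<close>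

definition spin_rep :: "nat \<Rightarrow> nat \<Rightarrow> (nat \<Rightarrow> complex mat) \<Rightarrow> bool" where
  "spin_rep n d T \<longleftrightarrow>
    (\<forall>i\<in>{1..<n}. T i \<in> carrier_mat d d \<and> T i * T i = - 1\<^sub>m d) \<and>
    (\<forall>i\<in>{1..<n}. i + 1 < n \<longrightarrow> T i * T (i + 1) * T i = T (i + 1) * T i * T (i + 1)) \<and>
    (\<forall>i\<in>{1..<n}. \<forall>j\<in>{1..<n}. i + 1 < j \<longrightarrow> T i * T j = - (T j * T i))"

definition irreducible_rep :: "nat \<Rightarrow> nat \<Rightarrow> (nat \<Rightarrow> complex mat) \<Rightarrow> bool" where
  "irreducible_rep n d T \<longleftrightarrow> d > 0 \<and>
    (\<forall>W. W \<subseteq> carrier_vec d \<and> 0\<^sub>v d \<in> W \<and>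
         (\<forall>v\<in>W. \<forall>w\<in>W. v + w \<in> W) \<and> (\<forall>c. \<forall>v\<in>W. c \<cdot>\<^sub>v v \<in> W) \<and>
         (\<forall>i\<in>{1..<n}. \<forall>v\<in>W. T i *\<^sub>v v \<in> W)
       \<longrightarrow> W = {0\<^sub>v d} \<or> W = carrier_vec d)"

text \<open>The standard representative of the class indexed by \<open>\<mu>\<close> is the product, in increasing
  order, of the \<open>t\<^sub>i\<close> with \<open>1 \<le> i < n\<close> that do not join two consecutive blocks of lengths
  \<open>\<mu>\<^sub>1, \<mu>\<^sub>2, \<dots>\<close>, i.e. with \<open>i\<close> not of the form \<open>\<mu>\<^sub>1 + \<dots> + \<mu>\<^sub>j\<close>. It lifts a permutation of cycle
  type \<open>\<mu>\<close>.\<close>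

definition class_word :: "partition \<Rightarrow> nat list" where
  "class_word mu = filter (\<lambda>i. \<forall>j. i \<noteq> sum_list (take j mu)) [1..<sum_list mu]"

definition rep_character :: "nat \<Rightarrow> (nat \<Rightarrow> complex mat) \<Rightarrow> partition \<Rightarrow> complex" where
  "rep_character d T mu =
    (let M = foldr (\<lambda>i A. T i * A) (class_word mu) (1\<^sub>m d) in \<Sum>i<d. M $$ (i, i))"

text \<open>\<open>zeta\<close> gives the values, on the classes indexed by \<open>OP n\<close>, of the irreducible negative
  character labelled by the strict partition \<open>\<lambda>\<close>. The labelling is the one fixed by Schur's
  formula; the two associate characters with the same label for \<open>eps \<lambda> = 1\<close> agree on these
  classes.\<close>

definition irreducible_spin_character :: "partition \<Rightarrow> (partition \<Rightarrow> complex) \<Rightarrow> bool" where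
  "irreducible_spin_character lam zeta \<longleftrightarrow>
    (\<exists>d T. spin_rep (sum_list lam) d T \<and> irreducible_rep (sum_list lam) d T \<and>
           (\<forall>mu\<in>OP (sum_list lam). zeta mu = rep_character d T mu)) \<and>
    Q_fun lam =
      (\<Sum>mu\<in>OP (sum_list lam).
         scalar (inverse (of_nat (z_stat mu)) *
           const_ratfun (of_real (2 powr ((real (length lam) + real (length mu) + real (eps lam)) / 2))
             * zeta mu)) * psum_part mu)"

end

theory Submission
  imports Defs
begin

text \<open>For arbitrary weights \<open>c\<close> let \<open>V\<^sub>k\<close> be the modes of the vertex operator with right factor
  \<open>exp (\<Sum> c\<^sub>n (\<partial>/\<partial>p\<^sub>n) z\<^sup>-\<^sup>n)\<close>, so that \<open>c\<^sub>n = t\<^sup>n - 1\<close> gives \<open>G\<close> and \<open>c\<^sub>n = -1\<close> gives \<open>Q\<close>. With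
  \<open>d\<^sub>a = (a/2) \<partial>/\<partial>p\<^sub>a\<close>, everything follows from the commutation rules \<open>V\<^sub>k p\<^sub>a = p\<^sub>a V\<^sub>k + c\<^sub>a V\<^bsub>k+a\<^esub>\<close> and
  \<open>d\<^sub>a V\<^sub>k = V\<^sub>k d\<^sub>a + V\<^bsub>k-a\<^esub>\<close>. The spin Green polynomial \<open>Y\<^sup>\<lambda>\<^sub>\<mu>\<close> is the constant term of \<open>d\<^sub>\<mu> G\<^sub>\<lambda>\<close>. Moving \<open>d\<^sub>\<mu>\<close>
  past the first mode produces the sum over subpartitions of \<open>\<mu>\<close>, and the constant term of
  \<open>V\<^bsub>-j\<^esub> g\<close> is a sum over \<open>\<rho> \<in> OP j\<close>: this is (6). The degree statement (2) and the
  specialisation \<open>t = 0\<close> follow from (6) by induction on \<open>l(\<lambda>)\<close>, and (5) follows from (6) and a closed form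
  of \<open>\<Sum> (-2)\<^bsup>l(\<rho>)\<^esup> / z\<^sub>\<rho>(t)\<close>. For (1), the modes of \<open>Q\<close> satisfy the Clifford relation
  \<open>Q\<^sub>m Q\<^sub>n + Q\<^sub>n Q\<^sub>m = 2 (-1)\<^sup>m\<close> if \<open>m + n = 0\<close> and \<open>0\<close> otherwise, which shows that the \<open>Q\<^sub>\<nu>\<close>, \<open>\<nu>\<close> strict, form a basis.\<close>

section \<open>The ring \<open>\<Gamma>\<close>\<close>

lemma of_nat_fract: "(of_nat n :: 'a :: idom fract) = Fraction_Field.Fract (of_nat n) 1"
  by (induction n) (simp_all add: Zero_fract_def One_fract_def)

text \<open>Factorials, \<open>z_stat\<close> and powers of 2 occur as denominators in this field,
  so nonzero naturals must be invertible there.\<close>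

instance fract :: ("{idom, ring_char_0}") field_char_0
proof
  show "inj (of_nat :: nat \<Rightarrow> 'a fract)"
    by (rule injI) (simp add: of_nat_fract eq_fract)
qed

lemma lookup_scalar_mult [simp]: "Poly_Mapping.lookup (scalar c * f) m = c * Poly_Mapping.lookup f m"
  unfolding scalar_def mult_map_scale_conv_mult[symmetric] by (simp add: map.rep_eq when_def)

lemma scalar_0 [simp]: "scalar 0 = 0" and scalar_1 [simp]: "scalar 1 = 1"
  by (simp_all add: scalar_def)

lemma scalar_add: "scalar (a + b) = scalar a + scalar b"
  by (simp add: scalar_def single_add)

lemma scalar_mult: "scalar (a * b) = scalar a * scalar b"
  by (simp add: scalar_def mult_single)

lemma scalar_uminus: "scalar (- a) = - scalar a"
  by (simp add: scalar_def single_uminus)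

lemma scalar_of_nat: "scalar (of_nat n) = of_nat n"
  by (simp add: scalar_def)

lemma lookup_scalar: "Poly_Mapping.lookup (scalar c) m = (if m = 0 then c else 0)"
  by (simp add: scalar_def lookup_single when_def)

text \<open>The exponent vector of \<open>psum a\<close>; odd \<open>a = 2k + 1\<close> occupies
  coordinate \<open>k\<close>.\<close>

definition var_exp :: "nat \<Rightarrow> (nat \<Rightarrow>\<^sub>0 nat)" where
  "var_exp a = Poly_Mapping.single (a div 2) 1"

lemma lookup_var_exp: "Poly_Mapping.lookup (var_exp a) k = (if a div 2 = k then 1 else 0)"
  by (simp add: var_exp_def lookup_single when_def)

lemma psum_eq: "psum a = Poly_Mapping.single (var_exp a) 1"
  by (simp add: psum_def var_exp_def)

lemma add_minus_var_exp:
  assumes "Poly_Mapping.lookup m (a div 2) \<noteq> 0"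
  shows "m - var_exp a + var_exp a = m"
  using assms by (intro poly_mapping_eqI) (auto simp: lookup_add lookup_minus lookup_var_exp)

lemma lookup_psum_mult:
  "Poly_Mapping.lookup (psum a * f) m = Sum_any (\<lambda>q. Poly_Mapping.lookup f q when m = var_exp a + q)"
  by (simp add: psum_eq lookup_mult lookup_single when_mult)

lemma lookup_psum_mult_add [simp]:
  "Poly_Mapping.lookup (psum a * f) (m + var_exp a) = Poly_Mapping.lookup f m"
  by (simp add: lookup_psum_mult add.commute[of m])

lemma lookup_psum_mult_0:
  assumes "Poly_Mapping.lookup m (a div 2) = 0"
  shows "Poly_Mapping.lookup (psum a * f) m = 0"
proof -
  have "m \<noteq> var_exp a + q" for q
    using assms by (auto simp: lookup_add lookup_var_exp)
  thus ?thesis by (simp add: lookup_psum_mult)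
qed

text \<open>Only the monomial \<open>m + var_exp a\<close> of \<open>f\<close> is differentiated to
  \<open>m\<close>. The truncated subtraction in \<open>dpsum_def\<close> does no harm, since a
  monomial free of the variable carries the coefficient 0.\<close>

lemma lookup_dpsum:
  "Poly_Mapping.lookup (dpsum a f) m =
     of_nat (Poly_Mapping.lookup m (a div 2) + 1) * Poly_Mapping.lookup f (m + var_exp a)"
proof -
  have *: "Poly_Mapping.lookup
       (Poly_Mapping.single (x - var_exp a) (of_nat (Poly_Mapping.lookup x (a div 2)) * Poly_Mapping.lookup f x)) m
     = (if x = m + var_exp a then of_nat (Poly_Mapping.lookup m (a div 2) + 1) * Poly_Mapping.lookup f x else 0)" for x
  proof (cases "Poly_Mapping.lookup x (a div 2) = 0")
    case True
    hence "x \<noteq> m + var_exp a" by (auto simp: lookup_add lookup_var_exp)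
    thus ?thesis using True by simp
  next
    case False
    hence "x - var_exp a = m \<longleftrightarrow> x = m + var_exp a"
      by (metis add_minus_var_exp add_diff_cancel_right')
    thus ?thesis by (auto simp: lookup_single when_def lookup_add lookup_var_exp)
  qed
  show ?thesis
    unfolding dpsum_def lookup_sum var_exp_def[symmetric] *
    by (auto simp: sum.delta not_in_keys_iff_lookup_eq_zero)
qed

lemma dpsum_add: "dpsum a (f + g) = dpsum a f + dpsum a g"
  by (rule poly_mapping_eqI) (simp only: lookup_dpsum lookup_add distrib_left)

lemma dpsum_scalar_mult: "dpsum a (scalar c * f) = scalar c * dpsum a f"
  by (rule poly_mapping_eqI) (simp only: lookup_dpsum lookup_scalar_mult mult.left_commute)

lemma dpsum_1 [simp]: "dpsum a 1 = 0"
proof (rule poly_mapping_eqI)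
  fix m
  have "m + var_exp a \<noteq> 0"
    by (metis add_eq_0_iff_both_eq_0 lookup_add lookup_var_exp lookup_zero one_neq_zero)
  thus "Poly_Mapping.lookup (dpsum a 1) m = Poly_Mapping.lookup 0 m"
    by (simp only: lookup_dpsum lookup_one) simp
qed

lemma dpsum_commute: "dpsum a (dpsum b f) = dpsum b (dpsum a f)"
proof (cases "a div 2 = b div 2")
  case True
  hence "dpsum a = dpsum b" by (simp add: fun_eq_iff dpsum_def)
  thus ?thesis by simp
next
  case False
  show ?thesis
  proof (rule poly_mapping_eqI)
    fix m
    have "m + var_exp a + var_exp b = m + var_exp b + var_exp a" by (simp add: algebra_simps)
    thus "Poly_Mapping.lookup (dpsum a (dpsum b f)) m = Poly_Mapping.lookup (dpsum b (dpsum a f)) m"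
      using False by (simp only: lookup_dpsum lookup_add lookup_var_exp) (simp add: mult.left_commute)
  qed
qed

text \<open>The Leibniz rule. Oddness makes \<open>a div 2\<close> determine
  \<open>a\<close>.\<close>

lemma dpsum_psum_mult:
  assumes "odd a" "odd b"
  shows "dpsum a (psum b * f) = (if a = b then f else 0) + psum b * dpsum a f"
proof (rule poly_mapping_eqI)
  fix m
  show "Poly_Mapping.lookup (dpsum a (psum b * f)) m =
        Poly_Mapping.lookup ((if a = b then f else 0) + psum b * dpsum a f) m"
  proof (cases "Poly_Mapping.lookup m (b div 2) = 0")
    case m0: True
    have ab: "a div 2 = b div 2 \<longleftrightarrow> a = b" using assms by presburger
    show ?thesis
    proof (cases "a = b")
      case True
      thus ?thesis using m0 by (simp add: lookup_dpsum lookup_add lookup_psum_mult_0)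
    next
      case False
      hence "Poly_Mapping.lookup (m + var_exp a) (b div 2) = 0"
        using m0 ab by (simp add: lookup_add lookup_var_exp)
      thus ?thesis using False m0 by (simp add: lookup_dpsum lookup_add lookup_psum_mult_0)
    qed
  next
    case False
    define m' where "m' = m - var_exp b"
    have m: "m = m' + var_exp b" using add_minus_var_exp[OF False] by (simp add: m'_def)
    have ab: "a div 2 = b div 2 \<longleftrightarrow> a = b" using assms by presburger
    have "Poly_Mapping.lookup (dpsum a (psum b * f)) m =
       of_nat (Poly_Mapping.lookup m (a div 2) + 1) * Poly_Mapping.lookup (psum b * f) ((m' + var_exp a) + var_exp b)"
      unfolding lookup_dpsum m by (simp add: ac_simps)
    also have "\<dots> = of_nat (Poly_Mapping.lookup m (a div 2) + 1) * Poly_Mapping.lookup f (m' + var_exp a)"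
      by (simp only: lookup_psum_mult_add)
    also have "\<dots> = Poly_Mapping.lookup ((if a = b then f else 0) + psum b * dpsum a f) m"
      unfolding m lookup_add lookup_psum_mult_add lookup_dpsum lookup_var_exp
      using ab by (auto simp: algebra_simps)
    finally show ?thesis .
  qed
qed

lemma gamma_monomials: "f = (\<Sum>m\<in>Poly_Mapping.keys f. scalar (Poly_Mapping.lookup f m) * Poly_Mapping.single m 1)"
  for f :: gamma
  by (rule poly_mapping_eqI)
    (auto simp: lookup_sum lookup_single when_def not_in_keys_iff_lookup_eq_zero if_distrib sum.delta cong: if_cong)

text \<open>Induction on the total degree: a nonzero exponent vector loses one generator.\<close>

lemma exponent_induct [case_names zero add]:
  assumes zero: "P 0" and add: "\<And>a m. odd a \<Longrightarrow> P m \<Longrightarrow> P (var_exp a + m)"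
  shows "P (m :: nat \<Rightarrow>\<^sub>0 nat)"
proof (induction "\<Sum>k\<in>Poly_Mapping.keys m. Poly_Mapping.lookup m k" arbitrary: m rule: less_induct)
  case less
  show ?case
  proof (cases "m = 0")
    case False
    then obtain k where k: "Poly_Mapping.lookup m k \<noteq> 0"
      by (metis lookup_zero poly_mapping_eqI)
    define a where "a = 2 * k + 1"
    define m' where "m' = m - var_exp a"
    have m: "m = m' + var_exp a" using add_minus_var_exp[of m a] k by (simp add: m'_def a_def)
    have l: "Poly_Mapping.lookup m j = Poly_Mapping.lookup m' j + (if k = j then 1 else 0)" for j
      by (simp add: m lookup_add lookup_var_exp a_def)
    have sub: "Poly_Mapping.keys m' \<subseteq> Poly_Mapping.keys m"
      using l by (auto simp: in_keys_iff)
    have "(\<Sum>j\<in>Poly_Mapping.keys m'. Poly_Mapping.lookup m' j) = (\<Sum>j\<in>Poly_Mapping.keys m. Poly_Mapping.lookup m' j)"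
      using sub by (intro sum.mono_neutral_left) (auto simp: in_keys_iff)
    also have "\<dots> < (\<Sum>j\<in>Poly_Mapping.keys m. Poly_Mapping.lookup m j)"
      using k by (intro sum_strict_mono_ex1) (auto simp: l in_keys_iff)
    finally have "P m'" by (rule less)
    hence "P (var_exp a + m')" by (rule add[rotated]) (simp add: a_def)
    thus ?thesis by (simp add: m add.commute)
  qed (use zero in simp)
qed

text \<open>Every element is a linear combination of monomials built from 1 by generators.
  Identities between linear operators thus reduce to the vacuum and one commutation with
  \<open>psum a\<close>.\<close>

lemma gamma_induct [case_names one add scalar psum]:
  assumes one: "P 1" and add: "\<And>f g. P f \<Longrightarrow> P g \<Longrightarrow> P (f + g)" and scal: "\<And>c f. P f \<Longrightarrow> P (scalar c * f)"
    and psum: "\<And>a f. odd a \<Longrightarrow> P f \<Longrightarrow> P (psum a * f)"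
  shows "P (f :: gamma)"
proof -
  have zero: "P 0" using scal[OF one, of 0] by simp
  have sum: "P (sum g A)" if "\<And>x. x \<in> A \<Longrightarrow> P (g x)" for g and A :: "(nat \<Rightarrow>\<^sub>0 nat) set"
    using that by (induction A rule: infinite_finite_induct) (auto intro: zero add)
  have mon: "P (Poly_Mapping.single m 1)" for m
  proof (induction m rule: exponent_induct)
    case zero
    show ?case using one by simp
  next
    case (add a m)
    from psum[OF this] show ?case by (simp add: psum_eq mult_single)
  qed
  show ?thesis
    by (subst gamma_monomials) (intro sum scal mon)
qed

section \<open>Commutation rules of vertex operators\<close>

lemma of_nat_mult_left_cancel:
  assumes "n > 0" "of_nat n * f = of_nat n * (g :: gamma)"
  shows "f = g"
proof -
  have "scalar (1 / of_nat n) * (scalar (of_nat n) * f) = scalar (1 / of_nat n) * (scalar (of_nat n) * g)"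
    using assms(2) by (simp add: scalar_of_nat)
  thus ?thesis using assms(1) by (simp flip: scalar_mult mult.assoc)
qed

section \<open>Coefficients of the creation exponential\<close>

lemma psum_series_power_nth_0:
  assumes "m < k"
  shows "fps_nth (psum_series ^ k) m = 0"
  using assms startsby_zero_power_prefix[of psum_series k] by (simp add: psum_series_def)

text \<open>A common bound lets the sums for different \<open>m\<close> be combined.\<close>

lemma creation_coeff_extend:
  assumes "m \<le> N"
  shows "creation_coeff m = (\<Sum>k\<le>N. scalar (1 / of_nat (fact k)) * fps_nth (psum_series ^ k) m)"
  unfolding creation_coeff_def
  using assms by (intro sum.mono_neutral_left) (auto simp: psum_series_power_nth_0)

lemma creation_coeff_0 [simp]: "creation_coeff 0 = 1"
  by (simp add: creation_coeff_def)

lemma scalar_inverse_fact_Suc: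
  "scalar (1 / of_nat (fact (Suc k))) * of_nat (Suc k) = scalar (1 / of_nat (fact k))"
proof -
  have "(1 / of_nat (fact (Suc k)) * of_nat (Suc k) :: ratfun) = 1 / of_nat (fact k)"
    by (simp only: fact_Suc of_nat_mult of_nat_id) (simp del: of_nat_Suc)
  thus ?thesis unfolding scalar_of_nat[symmetric] scalar_mult[symmetric] by simp
qed

text \<open>Coefficients are compared in \<open>z d/dz exp A(z) = (z A'(z)) exp A(z)\<close>, where
  \<open>z A'(z)\<close> has the coefficient \<open>2 p_a\<close> at \<open>z^a\<close> for odd
  \<open>a\<close> and 0 otherwise.\<close>

lemma creation_coeff_rec:
  "of_nat m * creation_coeff m = (\<Sum>a\<in>{a. odd a \<and> a \<le> m}. 2 * psum a * creation_coeff (m - a))"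
proof -
  let ?A = "psum_series"
  have E: "fps_nth (fps_X * fps_deriv ?A) a = (if odd a then 2 * psum a else 0)" for a
  proof (cases "odd a")
    case True
    then obtain j where j: "a = Suc j" by (cases a) auto
    have "scalar (of_nat a) * scalar (2 / of_nat a) = 2"
      using j scalar_of_nat[of 2] by (simp flip: scalar_mult del: of_nat_Suc)
    thus ?thesis using True j
      by (simp add: psum_series_def scalar_of_nat mult.assoc[symmetric] del: of_nat_Suc)
  next
    case False
    thus ?thesis by (cases a) (simp_all add: psum_series_def)
  qed
  have D: "of_nat m * fps_nth (?A ^ Suc k) m =
      of_nat (Suc k) * (\<Sum>a\<in>{a. odd a \<and> a \<le> m}. 2 * psum a * fps_nth (?A ^ k) (m - a))" for k
  proof -
    have "of_nat m * fps_nth (?A ^ Suc k) m = fps_nth (fps_X * fps_deriv (?A ^ Suc k)) m"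
      by (cases m) (simp_all del: power_Suc)
    also have "fps_X * fps_deriv (?A ^ Suc k) = of_nat (Suc k) * ((fps_X * fps_deriv ?A) * ?A ^ k)"
      by (simp only: fps_deriv_power fps_of_nat) (simp only: diff_Suc_1 mult_ac)
    also have "fps_nth \<dots> m = of_nat (Suc k) * fps_nth ((fps_X * fps_deriv ?A) * ?A ^ k) m"
      by (simp only: fps_mult_left_const_nth fps_of_nat[symmetric])
    also have "fps_nth ((fps_X * fps_deriv ?A) * ?A ^ k) m =
        (\<Sum>a\<in>{0..m}. (if odd a then 2 * psum a else 0) * fps_nth (?A ^ k) (m - a))"
      unfolding fps_mult_nth[of "fps_X * fps_deriv ?A"] E ..
    also have "\<dots> = (\<Sum>a\<in>{a. odd a \<and> a \<le> m}. 2 * psum a * fps_nth (?A ^ k) (m - a))"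
      by (intro sum.mono_neutral_cong_right) auto
    finally show ?thesis .
  qed
  \<comment> \<open>The bound \<open>Suc m\<close> leaves room for the shift of \<open>k\<close>;
    the term \<open>k = 0\<close> drops out because \<open>m\<close> times the coefficient of
    \<open>z^m\<close> in 1 is 0.\<close>
  have "of_nat m * creation_coeff m =
      (\<Sum>k\<le>Suc m. scalar (1 / of_nat (fact k)) * (of_nat m * fps_nth (?A ^ k) m))"
    unfolding creation_coeff_extend[OF le_SucI[OF le_refl], of m] sum_distrib_left by (simp only: mult.left_commute)
  also have "\<dots> = (\<Sum>k\<le>m. scalar (1 / of_nat (fact (Suc k))) * (of_nat m * fps_nth (?A ^ Suc k) m))"
    by (subst sum.atMost_Suc_shift) (cases m, simp_all del: power_Suc fact_Suc)
  also have "\<dots> = (\<Sum>k\<le>m. scalar (1 / of_nat (fact k)) *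
       (\<Sum>a\<in>{a. odd a \<and> a \<le> m}. 2 * psum a * fps_nth (?A ^ k) (m - a)))"
    unfolding D mult.assoc[symmetric] scalar_inverse_fact_Suc ..
  also have "\<dots> = (\<Sum>a\<in>{a. odd a \<and> a \<le> m}. 2 * psum a * (\<Sum>k\<le>m. scalar (1 / of_nat (fact k)) * fps_nth (?A ^ k) (m - a)))"
    unfolding sum_distrib_left by (subst sum.swap) (simp only: mult_ac)
  also have "\<dots> = (\<Sum>a\<in>{a. odd a \<and> a \<le> m}. 2 * psum a * creation_coeff (m - a))"
    using creation_coeff_extend[of _ m] by simp
  finally show ?thesis .
qed

section \<open>Creation modes with integer index and half-derivatives\<close>

definition creation :: "int \<Rightarrow> gamma" where
  "creation k = (if k \<ge> 0 then creation_coeff (nat k) else 0)"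

text \<open>The factor \<open>a / 2\<close> turns differentiation of \<open>exp (\<Sum> (2/n) p\<^sub>n z\<^sup>n)\<close> into an index shift.\<close>

definition half_deriv :: "nat \<Rightarrow> gamma \<Rightarrow> gamma" where
  "half_deriv a f = scalar (of_nat a / 2) * dpsum a f"

lemma half_deriv_add: "half_deriv a (f + g) = half_deriv a f + half_deriv a g"
  by (simp add: half_deriv_def dpsum_add distrib_left)

lemma half_deriv_scalar_mult: "half_deriv a (scalar c * f) = scalar c * half_deriv a f"
  by (simp add: half_deriv_def dpsum_scalar_mult mult.left_commute)

lemma half_deriv_0 [simp]: "half_deriv a 0 = 0"
  using half_deriv_scalar_mult[of a 0 0] by simp

lemma half_deriv_1 [simp]: "half_deriv a 1 = 0"
  by (simp add: half_deriv_def)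

lemma half_deriv_sum: "half_deriv a (sum f A) = (\<Sum>x\<in>A. half_deriv a (f x))"
  by (induction A rule: infinite_finite_induct) (simp_all add: half_deriv_add)

lemma half_deriv_of_nat_mult: "half_deriv a (of_nat n * f) = of_nat n * half_deriv a f"
  using half_deriv_scalar_mult[of a "of_nat n" f] by (simp add: scalar_of_nat)

lemma half_deriv_commute: "half_deriv a (half_deriv b f) = half_deriv b (half_deriv a f)"
  by (simp add: half_deriv_def dpsum_scalar_mult dpsum_commute[of a b] mult.left_commute)

lemma half_deriv_psum_mult:
  assumes "odd a" "odd b"
  shows "half_deriv a (psum b * f) = (if a = b then scalar (of_nat a / 2) * f else 0) + psum b * half_deriv a f"
  using assms by (simp add: half_deriv_def dpsum_psum_mult distrib_left mult.left_commute)

text \<open>On generating functions \<open>half_deriv b\<close> multiplies \<open>exp A(z)\<close>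
  by \<open>z^b\<close>, since \<open>(b/2) (2/b) = 1\<close>. The induction differentiates
  \<open>creation_coeff_rec\<close>: the summand \<open>a = b\<close> gives the factor
  \<open>b\<close>, the others reassemble to \<open>m - b\<close> by the same recursion, and the
  total factor \<open>m\<close> cancels.\<close>

lemma half_deriv_creation_coeff:
  assumes "odd b"
  shows "half_deriv b (creation_coeff m) = (if b \<le> m then creation_coeff (m - b) else 0)"
proof (induction m rule: less_induct)
  case (less m)
  show ?case
  proof (cases "m = 0")
    case True
    thus ?thesis using assms by (auto elim: oddE)
  next
    case m0: False
    let ?S = "\<lambda>m. {a. odd a \<and> a \<le> m}"
    have two: "2 * scalar (of_nat b / 2) = of_nat b"
      using scalar_mult[of 2 "of_nat b / 2"] scalar_of_nat[of 2] scalar_of_nat[of b] by simp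
    have two': "half_deriv b (2 * x) = 2 * half_deriv b x" for x
      using half_deriv_of_nat_mult[of b 2 x] by simp
    have odd0: "a > 0" if "a \<in> ?S m" for a using that by (auto elim: oddE)
    have fin: "finite (?S m)" by (rule finite_subset[of _ "{..m}"]) auto
    have "of_nat m * half_deriv b (creation_coeff m) = half_deriv b (of_nat m * creation_coeff m)"
      by (simp add: half_deriv_of_nat_mult)
    also have "\<dots> = (\<Sum>a\<in>?S m. 2 * half_deriv b (psum a * creation_coeff (m - a)))"
      unfolding creation_coeff_rec half_deriv_sum mult.assoc two' ..
    also have "\<dots> = (\<Sum>a\<in>?S m. (if a = b then of_nat b * creation_coeff (m - a) else 0) +
         2 * psum a * (if b \<le> m - a then creation_coeff (m - a - b) else 0))"
    proof (rule sum.cong[OF refl])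
      fix a assume a: "a \<in> ?S m"
      have "half_deriv b (creation_coeff (m - a)) = (if b \<le> m - a then creation_coeff (m - a - b) else 0)"
        using less[of "m - a"] odd0[OF a] m0 by simp
      thus "2 * half_deriv b (psum a * creation_coeff (m - a)) = (if a = b then of_nat b * creation_coeff (m - a) else 0) +
         2 * psum a * (if b \<le> m - a then creation_coeff (m - a - b) else 0)"
        using a assms by (auto simp: half_deriv_psum_mult two mult.assoc[symmetric] distrib_left)
    qed
    also have "\<dots> = (if b \<le> m then of_nat b * creation_coeff (m - b) else 0) +
         (\<Sum>a\<in>?S m. 2 * psum a * (if b \<le> m - a then creation_coeff (m - a - b) else 0))"
      using assms fin by (simp add: sum.distrib)
    also have "(\<Sum>a\<in>?S m. 2 * psum a * (if b \<le> m - a then creation_coeff (m - a - b) else 0)) =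
        (if b \<le> m then of_nat (m - b) * creation_coeff (m - b) else 0)"
    proof (cases "b \<le> m")
      case True
      have "(\<Sum>a\<in>?S m. 2 * psum a * (if b \<le> m - a then creation_coeff (m - a - b) else 0)) =
            (\<Sum>a\<in>?S (m - b). 2 * psum a * creation_coeff (m - b - a))"
        using True by (intro sum.mono_neutral_cong_right fin) (auto simp: add.commute)
      thus ?thesis using True creation_coeff_rec[of "m - b"] by simp
    next
      case False
      thus ?thesis by (auto intro!: sum.neutral)
    qed
    finally have "of_nat m * half_deriv b (creation_coeff m) = of_nat m * (if b \<le> m then creation_coeff (m - b) else 0)"
      by (simp add: distrib_right[symmetric] of_nat_add[symmetric] del: of_nat_add of_nat_diff)
    with m0 show ?thesis by (rule of_nat_mult_left_cancel[OF neq0_conv[THEN iffD1]])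
  qed
qed

text \<open>The convention \<open>creation k = 0\<close> for \<open>k < 0\<close> absorbs the case
  distinction.\<close>

lemma half_deriv_creation:
  assumes "odd b"
  shows "half_deriv b (creation k) = creation (k - int b)"
proof (cases "k \<ge> 0")
  case True
  then obtain m where "k = int m" by (metis nonneg_int_cases)
  thus ?thesis using assms by (simp add: creation_def half_deriv_creation_coeff flip: of_nat_diff)
qed (simp add: creation_def)

lemma creation_rec:
  "of_int k * creation k = (\<Sum>a\<in>{a. odd a \<and> int a \<le> k}. 2 * psum a * creation (k - int a))"
proof (cases "k \<ge> 0")
  case True
  have eq: "{a. odd a \<and> int a \<le> k} = {a. odd a \<and> a \<le> nat k}" using True by auto
  have k: "of_int k = (of_nat (nat k) :: gamma)" using True by simp
  show ?thesis unfolding k eq using True creation_coeff_rec[of "nat k"]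
    by (auto simp: creation_def nat_diff_distrib intro!: sum.cong)
next
  case False
  hence eq: "{a. odd a \<and> int a \<le> k} = {}" by auto
  show ?thesis unfolding eq using False by (simp add: creation_def)
qed

lemma creation_0 [simp]: "creation 0 = 1" and creation_neg: "k < 0 \<Longrightarrow> creation k = 0"
  by (simp_all add: creation_def)

section \<open>The annihilation exponential\<close>

lemma deriv_series_nth:
  "fps_nth (deriv_series c F) m = (\<Sum>n\<in>{n. odd n \<and> n \<le> m}. scalar (c n) * dpsum n (fps_nth F (m - n)))"
  by (simp add: deriv_series_def)

lemma dpsum_0 [simp]: "dpsum a 0 = 0"
  using dpsum_scalar_mult[of a 0 0] by simp

lemma deriv_series_add: "deriv_series c (F + G) = deriv_series c F + deriv_series c G"
  by (rule fps_ext) (simp add: deriv_series_nth dpsum_add distrib_left sum.distrib)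

lemma deriv_series_scalar: "deriv_series c (fps_const (scalar s) * F) = fps_const (scalar s) * deriv_series c F"
  by (rule fps_ext) (simp add: deriv_series_nth dpsum_scalar_mult sum_distrib_left mult.left_commute)

lemma deriv_series_X_power: "deriv_series c (fps_X ^ b * F) = fps_X ^ b * deriv_series c F"
proof (rule fps_ext)
  fix m
  show "fps_nth (deriv_series c (fps_X ^ b * F)) m = fps_nth (fps_X ^ b * deriv_series c F) m"
  proof (cases "m < b")
    case True
    thus ?thesis by (auto simp: deriv_series_nth fps_X_power_mult_nth intro!: sum.neutral)
  next
    case False
    have "(\<Sum>n | odd n \<and> n \<le> m. scalar (c n) * dpsum n (if m - n < b then 0 else fps_nth F (m - n - b))) =
          (\<Sum>n | odd n \<and> n \<le> m - b. scalar (c n) * dpsum n (fps_nth F (m - b - n)))"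
      using False by (intro sum.mono_neutral_cong_right) (auto simp: add.commute)
    thus ?thesis using False by (simp add: deriv_series_nth fps_X_power_mult_nth)
  qed
qed

text \<open>The commutator of \<open>B(w)\<close> with multiplication by \<open>p_b\<close> is the
  scalar series \<open>c_b w^b\<close>, coming from the Leibniz term with
  \<open>n = b\<close>.\<close>

lemma deriv_series_psum:
  assumes "odd b"
  shows "deriv_series c (fps_const (psum b) * F) =
           fps_const (psum b) * deriv_series c F + fps_X ^ b * (fps_const (scalar (c b)) * F)"
proof (rule fps_ext)
  fix m :: nat
  have fin: "finite {n. odd n \<and> n \<le> m}" by (rule finite_subset[of _ "{..m}"]) auto
  have "fps_nth (deriv_series c (fps_const (psum b) * F)) m =
     (\<Sum>n | odd n \<and> n \<le> m. (if n = b then scalar (c n) * fps_nth F (m - n) else 0) +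
        psum b * (scalar (c n) * dpsum n (fps_nth F (m - n))))"
    unfolding deriv_series_nth fps_mult_left_const_nth
    using assms by (intro sum.cong refl) (auto simp: dpsum_psum_mult distrib_left mult.left_commute)
  thus "fps_nth (deriv_series c (fps_const (psum b) * F)) m =
     fps_nth (fps_const (psum b) * deriv_series c F + fps_X ^ b * (fps_const (scalar (c b)) * F)) m"
    using fin assms
    by (simp only: sum.distrib fps_X_power_mult_nth deriv_series_nth sum_distrib_left fps_add_nth fps_mult_left_const_nth)
      (simp add: not_less)
qed

lemma deriv_series_pow_add:
  "(deriv_series c ^^ k) (F + G) = (deriv_series c ^^ k) F + (deriv_series c ^^ k) G"
  by (induction k) (simp_all add: deriv_series_add)

lemma deriv_series_pow_scalar:
  "(deriv_series c ^^ k) (fps_const (scalar s) * F) = fps_const (scalar s) * (deriv_series c ^^ k) F"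
  by (induction k) (simp_all add: deriv_series_scalar)

text \<open>\<open>B(w)\<close> contains only powers \<open>w^n\<close> with
  \<open>n \<ge> 1\<close>, so each application raises the order in \<open>w\<close>.\<close>

lemma deriv_series_pow_nth_0:
  assumes "m < k"
  shows "fps_nth ((deriv_series c ^^ k) F) m = 0"
  using assms
proof (induction k arbitrary: m)
  case (Suc k)
  have "fps_nth ((deriv_series c ^^ k) F) (m - n) = 0" if "odd n" "n \<le> m" for n
    using that Suc.prems by (intro Suc.IH) (auto elim!: oddE)
  thus ?case by (simp add: deriv_series_nth)
qed simp

text \<open>The commutator \<open>c_b w^b\<close> commutes with \<open>B(w)\<close>, so passing
  \<open>p_b\<close> through \<open>Suc k\<close> factors produces it \<open>Suc k\<close>
  times.\<close>

lemma deriv_series_pow_psum: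
  assumes "odd b"
  shows "(deriv_series c ^^ Suc k) (fps_const (psum b) * F) = fps_const (psum b) * (deriv_series c ^^ Suc k) F +
           fps_X ^ b * (fps_const (scalar (of_nat (Suc k) * c b)) * (deriv_series c ^^ k) F)"
proof (induction k)
  case 0
  show ?case using assms by (simp add: deriv_series_psum)
next
  case (Suc k)
  have S: "(deriv_series c ^^ Suc n) x = deriv_series c ((deriv_series c ^^ n) x)" for n x by simp
  have "(deriv_series c ^^ Suc (Suc k)) (fps_const (psum b) * F) =
      fps_const (psum b) * (deriv_series c ^^ Suc (Suc k)) F +
        (fps_X ^ b * (fps_const (scalar (c b)) * (deriv_series c ^^ Suc k) F) +
        fps_X ^ b * (fps_const (scalar (of_nat (Suc k) * c b)) * (deriv_series c ^^ Suc k) F))"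
    unfolding S[of "Suc k"] Suc.IH deriv_series_add deriv_series_psum[OF assms]
      deriv_series_X_power deriv_series_scalar add.assoc
    unfolding S[symmetric] ..
  also have "fps_X ^ b * (fps_const (scalar (c b)) * (deriv_series c ^^ Suc k) F) +
        fps_X ^ b * (fps_const (scalar (of_nat (Suc k) * c b)) * (deriv_series c ^^ Suc k) F) =
        fps_X ^ b * (fps_const (scalar (of_nat (Suc (Suc k)) * c b)) * (deriv_series c ^^ Suc k) F)"
    unfolding distrib_left[symmetric] distrib_right[symmetric] fps_const_add scalar_add[symmetric]
    by (simp only: of_nat_Suc[of "Suc k"] distrib_right mult_1_left)
  finally show ?case .
qed

lemma annihilation_coeff_extend:
  assumes "m \<le> N"
  shows "annihilation_coeff c m f =
    (\<Sum>k\<le>N. scalar (1 / of_nat (fact k)) * fps_nth ((deriv_series c ^^ k) (fps_const f)) m)"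
  unfolding annihilation_coeff_def
  using assms by (intro sum.mono_neutral_left) (auto simp: deriv_series_pow_nth_0)

lemma annihilation_coeff_add:
  "annihilation_coeff c m (f + g) = annihilation_coeff c m f + annihilation_coeff c m g"
  unfolding annihilation_coeff_def fps_const_add[symmetric] deriv_series_pow_add
  by (simp add: distrib_left sum.distrib)

lemma annihilation_coeff_scalar:
  "annihilation_coeff c m (scalar s * f) = scalar s * annihilation_coeff c m f"
  unfolding annihilation_coeff_def fps_const_mult[symmetric] deriv_series_pow_scalar
  by (simp add: sum_distrib_left mult.left_commute)

lemma annihilation_coeff_1: "annihilation_coeff c m 1 = (if m = 0 then 1 else 0)"
proof -
  have "deriv_series c 1 = 0"
    by (rule fps_ext) (auto simp: deriv_series_nth fps_one_nth intro!: sum.neutral)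
  moreover have "deriv_series c 0 = 0" by (rule fps_ext) (simp add: deriv_series_nth)
  ultimately have "(deriv_series c ^^ Suc k) 1 = 0" for k
    by (induction k) simp_all
  hence *: "(deriv_series c ^^ k) 1 = (if k = 0 then 1 else 0)" for k
    by (cases k) simp_all
  have "annihilation_coeff c m 1 = (\<Sum>k\<le>m. if k = 0 then (if m = 0 then 1 else 0) else 0)"
    unfolding annihilation_coeff_def fps_const_1_eq_1 * by (intro sum.cong) auto
  thus ?thesis by simp
qed

text \<open>\<open>exp B(w) p_b = (p_b + c_b w^b) exp B(w)\<close>: the factor \<open>Suc k\<close>
  from \<open>deriv_series_pow_psum\<close> turns \<open>1/(Suc k)!\<close> into
  \<open>1/k!\<close>.\<close>

lemma annihilation_coeff_psum:
  assumes "odd b"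
  shows "annihilation_coeff c m (psum b * f) =
     psum b * annihilation_coeff c m f + (if b \<le> m then scalar (c b) * annihilation_coeff c (m - b) f else 0)"
proof -
  let ?B = "\<lambda>k F. (deriv_series c ^^ k) F"
  let ?s = "\<lambda>k. scalar (1 / of_nat (fact k))"
  have fact: "?s (Suc k) * scalar (of_nat (Suc k) * x) = scalar x * ?s k" for k x
    unfolding scalar_mult mult.assoc[symmetric] scalar_of_nat scalar_inverse_fact_Suc
    by (rule mult.commute)
  have "annihilation_coeff c m (psum b * f) =
      (\<Sum>k\<le>Suc m. ?s k * fps_nth (?B k (fps_const (psum b) * fps_const f)) m)"
    by (subst annihilation_coeff_extend[of m "Suc m"]) (simp_all only: fps_const_mult le_SucI order_refl)
  also have "\<dots> = psum b * (?s 0 * fps_nth (fps_const f) m) +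
      (\<Sum>k\<le>m. ?s (Suc k) * fps_nth (?B (Suc k) (fps_const (psum b) * fps_const f)) m)"
    by (subst sum.atMost_Suc_shift) simp
  also have "(\<Sum>k\<le>m. ?s (Suc k) * fps_nth (?B (Suc k) (fps_const (psum b) * fps_const f)) m) =
     (\<Sum>k\<le>m. psum b * (?s (Suc k) * fps_nth (?B (Suc k) (fps_const f)) m) +
        (if b \<le> m then scalar (c b) * (?s k * fps_nth (?B k (fps_const f)) (m - b)) else 0))"
  proof (intro sum.cong refl)
    fix k
    show "?s (Suc k) * fps_nth (?B (Suc k) (fps_const (psum b) * fps_const f)) m =
       psum b * (?s (Suc k) * fps_nth (?B (Suc k) (fps_const f)) m) +
        (if b \<le> m then scalar (c b) * (?s k * fps_nth (?B k (fps_const f)) (m - b)) else 0)"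
    proof (cases "b \<le> m")
      case True
      have "?s (Suc k) * (scalar (of_nat (Suc k) * c b) * x) = scalar (c b) * (?s k * x)" for x
        using fact[of k "c b"] by (simp only: mult.assoc[symmetric])
      thus ?thesis
        unfolding deriv_series_pow_psum[OF assms] fps_add_nth fps_X_power_mult_nth fps_mult_left_const_nth
        using True by (simp only: distrib_left mult.left_commute[of _ "psum b"] not_less[symmetric] if_False if_True simp_thms)
    next
      case False
      thus ?thesis
        unfolding deriv_series_pow_psum[OF assms] fps_add_nth fps_X_power_mult_nth fps_mult_left_const_nth
        by (simp only: distrib_left mult.left_commute[of _ "psum b"] False not_le[THEN iffD1, OF False] if_False if_True mult_zero_right)
    qed
  qed
  also have "\<dots> = (\<Sum>k\<le>m. psum b * (?s (Suc k) * fps_nth (?B (Suc k) (fps_const f)) m)) +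
     (if b \<le> m then scalar (c b) * annihilation_coeff c (m - b) f else 0)"
    unfolding sum.distrib annihilation_coeff_extend[OF diff_le_self, of c m b f] sum_distrib_left
    by (cases "b \<le> m") (simp_all only: if_True if_False sum.neutral_const simp_thms)
  also have "psum b * (?s 0 * fps_nth (fps_const f) m) + ((\<Sum>k\<le>m. psum b * (?s (Suc k) * fps_nth (?B (Suc k) (fps_const f)) m)) +
     (if b \<le> m then scalar (c b) * annihilation_coeff c (m - b) f else 0)) =
     psum b * annihilation_coeff c m f + (if b \<le> m then scalar (c b) * annihilation_coeff c (m - b) f else 0)"
    unfolding annihilation_coeff_extend[OF le_SucI[OF order_refl], of c m f] sum.atMost_Suc_shift
    by (simp only: distrib_left sum_distrib_left add.assoc funpow_0)
  finally show ?thesis .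
qed

text \<open>Makes the sum over \<open>m\<close> in \<open>vertex_op\<close> finite. Multiplication
  by \<open>p_a\<close> raises the bound by at most \<open>a\<close>.\<close>

lemma annihilation_coeff_finite: "\<exists>N. \<forall>m\<ge>N. annihilation_coeff c m f = 0"
proof (induction f rule: gamma_induct)
  case one
  show ?case by (rule exI[of _ 1]) (auto simp: annihilation_coeff_1)
next
  case (add f g)
  then obtain N M where "\<forall>m\<ge>N. annihilation_coeff c m f = 0" "\<forall>m\<ge>M. annihilation_coeff c m g = 0" by auto
  thus ?case by (intro exI[of _ "max N M"]) (auto simp: annihilation_coeff_add)
next
  case (scalar s f)
  thus ?case by (auto simp: annihilation_coeff_scalar)
next
  case (psum a f)
  then obtain N where "\<forall>m\<ge>N. annihilation_coeff c m f = 0" by auto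
  thus ?case using psum(1) by (intro exI[of _ "N + a"]) (auto simp: annihilation_coeff_psum)
qed

section \<open>Modes of vertex operators and their commutation rules\<close>

lemma vertex_op_eq_sum:
  assumes "\<forall>m\<ge>N. annihilation_coeff c m f = 0"
  shows "vertex_op c n f = (\<Sum>m<N. creation (n + int m) * annihilation_coeff c m f)"
proof -
  have "vertex_op c n f = Sum_any (\<lambda>m. creation (n + int m) * annihilation_coeff c m f)"
    unfolding vertex_op_def creation_def by (rule Sum_any.cong) auto
  also have "\<dots> = (\<Sum>m<N. creation (n + int m) * annihilation_coeff c m f)"
    using assms by (intro Sum_any.expand_superset) (auto simp: not_less intro: ccontr)
  finally show ?thesis .
qed

lemma vertex_op_1: "vertex_op c n 1 = creation n"
  by (subst vertex_op_eq_sum[of 1]) (simp_all add: annihilation_coeff_1)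

lemma vertex_op_add: "vertex_op c n (f + g) = vertex_op c n f + vertex_op c n g"
proof -
  obtain N M where NM: "\<forall>m\<ge>N. annihilation_coeff c m f = 0" "\<forall>m\<ge>M. annihilation_coeff c m g = 0"
    using annihilation_coeff_finite by blast
  hence "\<forall>m\<ge>max N M. annihilation_coeff c m (f + g) = 0" "\<forall>m\<ge>max N M. annihilation_coeff c m f = 0"
    "\<forall>m\<ge>max N M. annihilation_coeff c m g = 0"
    by (auto simp: annihilation_coeff_add)
  thus ?thesis
    by (simp only: vertex_op_eq_sum[of "max N M"] annihilation_coeff_add distrib_left sum.distrib)
qed

lemma vertex_op_scalar: "vertex_op c n (scalar s * f) = scalar s * vertex_op c n f"
proof -
  obtain N where N: "\<forall>m\<ge>N. annihilation_coeff c m f = 0"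
    using annihilation_coeff_finite by blast
  hence "\<forall>m\<ge>N. annihilation_coeff c m (scalar s * f) = 0" by (auto simp: annihilation_coeff_scalar)
  thus ?thesis using N
    by (simp add: vertex_op_eq_sum[of N] annihilation_coeff_scalar sum_distrib_left mult.left_commute)
qed

lemma sum_shift_if:
  "(\<Sum>m<N + b. if b \<le> m then h (m - b) else 0) = (\<Sum>m<N. h m :: 'a :: comm_monoid_add)" for b N :: nat
  by (induction N) simp_all

text \<open>The creation factor commutes with multiplication by \<open>p_b\<close>, so only the term
  \<open>c_b z^-b\<close> of the annihilation factor appears; it shifts the mode from
  \<open>n\<close> to \<open>n + b\<close>.\<close>

lemma vertex_op_psum:
  assumes "odd b"
  shows "vertex_op c n (psum b * f) = psum b * vertex_op c n f + scalar (c b) * vertex_op c (n + int b) f"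
proof -
  obtain N where N: "\<forall>m\<ge>N. annihilation_coeff c m f = 0"
    using annihilation_coeff_finite by blast
  have Nb: "\<forall>m\<ge>N + b. annihilation_coeff c m f = 0" using N by auto
  have "\<forall>m\<ge>N + b. annihilation_coeff c m (psum b * f) = 0"
    using N assms by (auto simp: annihilation_coeff_psum)
  hence "vertex_op c n (psum b * f) = (\<Sum>m<N + b. creation (n + int m) * annihilation_coeff c m (psum b * f))"
    by (rule vertex_op_eq_sum)
  also have "\<dots> = (\<Sum>m<N + b. psum b * (creation (n + int m) * annihilation_coeff c m f) +
      (if b \<le> m then scalar (c b) * (creation (n + int b + int (m - b)) * annihilation_coeff c (m - b) f) else 0))"
    using assms by (intro sum.cong refl) (auto simp: annihilation_coeff_psum distrib_left mult.left_commute)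
  also have "\<dots> = psum b * vertex_op c n f + scalar (c b) * vertex_op c (n + int b) f"
    unfolding sum.distrib
      sum_shift_if[where h = "\<lambda>m. scalar (c b) * (creation (n + int b + int m) * annihilation_coeff c m f)"]
      vertex_op_eq_sum[OF Nb, of n] vertex_op_eq_sum[OF N, of "n + int b"] sum_distrib_left ..
  finally show ?thesis .
qed

lemma vertex_op_0 [simp]: "vertex_op c n 0 = 0"
  using vertex_op_scalar[of c n 0 0] by simp

lemma vertex_op_sum: "vertex_op c n (sum f A) = (\<Sum>x\<in>A. vertex_op c n (f x))"
  by (induction A rule: infinite_finite_induct) (simp_all add: vertex_op_add)

lemma vertex_op_uminus: "vertex_op c n (- f) = - vertex_op c n f"
  using vertex_op_scalar[of c n "-1" f] by (simp add: scalar_uminus)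

lemma add_add_swap_middle: "a + b + (c + d) = a + c + (b + d :: 'a :: comm_monoid_add)"
  by (simp only: ac_simps)

text \<open>\<open>half_deriv a\<close> commutes with the annihilation factor and multiplies the
  creation factor by \<open>z^a\<close>. The proof is by induction on \<open>f\<close>: on the
  vacuum this is \<open>half_deriv_creation\<close>, and in the generator case the shifts by
  \<open>a\<close> and \<open>b\<close> commute.\<close>

lemma half_deriv_vertex_op:
  assumes "odd a"
  shows "half_deriv a (vertex_op c n f) = vertex_op c (n - int a) f + vertex_op c n (half_deriv a f)"
proof (induction f arbitrary: n rule: gamma_induct)
  case one
  show ?case unfolding vertex_op_1 half_deriv_creation[OF assms] half_deriv_1 vertex_op_0 by (rule add_0_right[symmetric])
next
  case (add f g)
  show ?case unfolding vertex_op_add half_deriv_add add.IH by (rule add_add_swap_middle)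
next
  case (scalar s f)
  show ?case unfolding vertex_op_scalar half_deriv_scalar_mult scalar.IH by (rule distrib_left)
next
  case (psum b f)
  have eq: "n + int b - int a = n - int a + int b" by simp
  have v: "vertex_op c n (if a = b then x else 0) = (if a = b then vertex_op c n x else 0)" for x
    by (cases "a = b") simp_all
  show ?case
    unfolding vertex_op_psum[OF psum.hyps] half_deriv_psum_mult[OF assms psum.hyps] half_deriv_add half_deriv_scalar_mult
        vertex_op_add v vertex_op_scalar distrib_left eq psum.IH
    by (simp only: add_ac)
qed

section \<open>Constant terms and the recursion\<close>

definition odd_parts :: "partition \<Rightarrow> bool" where
  "odd_parts xs \<longleftrightarrow> (\<forall>x\<in>set xs. odd x)"

lemma odd_parts_simps [simp]:
  "odd_parts []" "odd_parts (a # xs) \<longleftrightarrow> odd a \<and> odd_parts xs"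
  "odd_parts (xs @ ys) \<longleftrightarrow> odd_parts xs \<and> odd_parts ys"
  by (auto simp: odd_parts_def)

lemma odd_parts_nths: "odd_parts xs \<Longrightarrow> odd_parts (nths xs I)"
  by (auto simp: odd_parts_def dest: in_set_nthsD)

lemma OP_iff: "xs \<in> OP n \<longleftrightarrow> is_partition xs \<and> odd_parts xs \<and> sum_list xs = n"
  by (simp add: OP_def odd_parts_def)

definition part_exp :: "partition \<Rightarrow> (nat \<Rightarrow>\<^sub>0 nat)" where
  "part_exp xs = sum_list (map var_exp xs)"

lemma part_exp_simps [simp]: "part_exp [] = 0" "part_exp (a # xs) = var_exp a + part_exp xs"
  by (simp_all add: part_exp_def)

lemma psum_part_simps [simp]: "psum_part [] = 1" "psum_part (a # xs) = psum a * psum_part xs"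
  by (simp_all add: psum_part_def)

lemma psum_part_eq: "psum_part xs = Poly_Mapping.single (part_exp xs) 1"
  by (induction xs) (simp_all add: psum_eq mult_single single_one)

lemma lookup_part_exp:
  assumes "odd_parts xs"
  shows "Poly_Mapping.lookup (part_exp xs) k = count_list xs (2 * k + 1)"
  using assms
proof (induction xs)
  case (Cons a xs)
  hence "a div 2 = k \<longleftrightarrow> a = 2 * k + 1" by (auto elim!: oddE)
  thus ?case using Cons by (simp add: lookup_add lookup_var_exp)
qed simp

lemma partition_eqI:
  assumes "is_partition xs" "is_partition ys" "mset xs = mset ys"
  shows "xs = ys"
proof -
  have "sorted (rev xs)" "sorted (rev ys)"
    using assms by (auto simp: is_partition_def sorted_wrt_rev)
  hence "rev xs = rev ys" using assms(3) by (metis mset_rev properties_for_sort)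
  thus ?thesis by simp
qed

text \<open>The exponent vector records the multiplicity of every odd number, and even parts do not
  occur; a sorted list is determined by its multiplicities.\<close>

lemma part_exp_inj:
  assumes "is_partition xs" "odd_parts xs" "is_partition ys" "odd_parts ys" "part_exp xs = part_exp ys"
  shows "xs = ys"
proof (rule partition_eqI)
  show "mset xs = mset ys"
  proof (rule multiset_eqI)
    fix a
    show "count (mset xs) a = count (mset ys) a"
    proof (cases "odd a")
      case True
      then obtain k where "a = 2 * k + 1" by (auto elim: oddE)
      thus ?thesis using assms(5) lookup_part_exp[OF assms(2), of k] lookup_part_exp[OF assms(4), of k]
        by (simp add: count_mset)
    next
      case False
      hence "a \<notin> set xs" "a \<notin> set ys" using assms by (auto simp: odd_parts_def)
      thus ?thesis by (simp add: count_list_0_iff count_mset)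
    qed
  qed
qed (use assms in auto)

lemma is_partition_rev_sort: "is_partition (rev (sort xs)) \<longleftrightarrow> 0 \<notin> set xs"
  by (simp add: is_partition_def sorted_wrt_rev)

lemma part_exp_mset: "mset xs = mset ys \<Longrightarrow> part_exp xs = part_exp ys"
  unfolding part_exp_def by (metis mset_map sum_mset_sum_list)

text \<open>Together with \<open>part_exp_inj\<close> this indexes the monomials of
  \<open>\<Gamma>\<close> by odd partitions.\<close>

lemma part_exp_surj:
  obtains xs where "is_partition xs" "odd_parts xs" "m = part_exp xs"
proof -
  have "\<exists>xs. odd_parts xs \<and> m = part_exp xs"
  proof (induction m rule: exponent_induct)
    case zero
    show ?case by (intro exI[of _ "[]"]) simp
  next
    case (add a m)
    then obtain xs where "odd_parts xs" "m = part_exp xs" by auto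
    thus ?case using add(1) by (intro exI[of _ "a # xs"]) simp
  qed
  then obtain xs where xs: "odd_parts xs" "m = part_exp xs" by auto
  hence "0 \<notin> set xs" by (auto simp: odd_parts_def)
  with xs part_exp_mset[of "rev (sort xs)" xs] show ?thesis
    by (intro that[of "rev (sort xs)"]) (auto simp: is_partition_rev_sort odd_parts_def)
qed

lemma finite_partitions: "finite {xs. is_partition xs \<and> sum_list xs = n}"
proof (rule finite_subset)
  show "{xs. is_partition xs \<and> sum_list xs = n} \<subseteq> {xs. set xs \<subseteq> {..n} \<and> length xs \<le> n}"
  proof safe
    fix xs :: partition and x :: nat assume xs: "is_partition xs" "n = sum_list xs"
    show "x \<le> sum_list xs" if "x \<in> set xs" using that by (auto intro: member_le_sum_list)
    have "length ys \<le> sum_list ys" if "0 \<notin> set ys" for ys :: "nat list"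
      using that by (induction ys) auto
    thus "length xs \<le> sum_list xs" using xs by (simp add: is_partition_def)
  qed
qed (intro finite_lists_length_le finite_atMost)

lemma finite_OP [simp]: "finite (OP n)" and finite_SP [simp]: "finite (SP n)"
  by (rule finite_subset[OF _ finite_partitions[of n]]; force simp: OP_def SP_def is_strict_def)+

lemma z_stat_superset:
  assumes "finite S" "set xs \<subseteq> S"
  shows "z_stat xs = (\<Prod>i\<in>S. i ^ count_list xs i * fact (count_list xs i))"
  unfolding z_stat_def using assms
  by (intro prod.mono_neutral_left) (auto simp: count_notin)

lemma z_stat_Nil [simp]: "z_stat [] = 1"
  by (simp add: z_stat_def)

text \<open>One more part \<open>a\<close> raises its multiplicity from \<open>m\<close> to
  \<open>m + 1\<close>, which multiplies \<open>a^m m!\<close> by \<open>a (m + 1)\<close>. The list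
  need not be sorted, so parts can be removed one at a time.\<close>

lemma z_stat_Cons: "z_stat (a # xs) = a * (count_list xs a + 1) * z_stat xs"
proof -
  let ?S = "set xs - {a}"
  have "z_stat (a # xs) = (\<Prod>i\<in>insert a ?S. i ^ count_list (a # xs) i * fact (count_list (a # xs) i))"
    by (rule z_stat_superset) auto
  also have "\<dots> = a * (count_list xs a + 1) * (a ^ count_list xs a * fact (count_list xs a) *
      (\<Prod>i\<in>?S. i ^ count_list xs i * fact (count_list xs i)))"
    by (subst prod.insert) (auto intro!: prod.cong simp: algebra_simps)
  also have "a ^ count_list xs a * fact (count_list xs a) *
      (\<Prod>i\<in>?S. i ^ count_list xs i * fact (count_list xs i)) =
      (\<Prod>i\<in>insert a ?S. i ^ count_list xs i * fact (count_list xs i))"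
    by (subst prod.insert) auto
  also have "\<dots> = z_stat xs" by (rule z_stat_superset[symmetric]) auto
  finally show ?thesis .
qed

lemma z_stat_pos: "0 \<notin> set xs \<Longrightarrow> z_stat xs > 0"
  by (induction xs) (auto simp: z_stat_Cons)

lemma odd_parts_0: "odd_parts xs \<Longrightarrow> 0 \<notin> set xs"
  by (auto simp: odd_parts_def)

section \<open>Iterated half-derivatives and constant terms\<close>

abbreviation const_term :: "gamma \<Rightarrow> ratfun" where
  "const_term f \<equiv> Poly_Mapping.lookup f 0"

definition half_deriv_part :: "partition \<Rightarrow> gamma \<Rightarrow> gamma" where
  "half_deriv_part xs = foldr half_deriv xs"

lemma half_deriv_part_simps [simp]:
  "half_deriv_part [] f = f"
  "half_deriv_part (a # xs) f = half_deriv a (half_deriv_part xs f)"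
  by (simp_all add: half_deriv_part_def)

lemma half_deriv_part_append: "half_deriv_part (xs @ ys) f = half_deriv_part xs (half_deriv_part ys f)"
  by (induction xs) simp_all

lemma half_deriv_part_commute: "half_deriv_part xs (half_deriv a f) = half_deriv a (half_deriv_part xs f)"
  by (induction xs) (simp_all add: half_deriv_commute)

lemma half_deriv_part_scalar: "half_deriv_part xs (scalar s * f) = scalar s * half_deriv_part xs f"
  by (induction xs) (simp_all add: half_deriv_scalar_mult)

lemma half_deriv_part_add: "half_deriv_part xs (f + g) = half_deriv_part xs f + half_deriv_part xs g"
  by (induction xs) (simp_all add: half_deriv_add)

lemma half_deriv_part_sum: "half_deriv_part xs (sum f A) = (\<Sum>x\<in>A. half_deriv_part xs (f x))"
  by (induction xs) (simp_all add: half_deriv_sum)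

lemma lookup_half_deriv:
  "Poly_Mapping.lookup (half_deriv a f) m =
     of_nat a / 2 * (of_nat (Poly_Mapping.lookup m (a div 2) + 1) * Poly_Mapping.lookup f (m + var_exp a))"
  by (simp only: half_deriv_def lookup_scalar_mult lookup_dpsum)

text \<open>Differentiating \<open>p_mu\<close> down to a constant yields the factorials of the
  multiplicities, and the factors \<open>a/2\<close> supply the rest of \<open>z_stat\<close> and
  the power of 2. This is the normalisation in the definition of the spin Green polynomials.\<close>

lemma const_term_half_deriv_part:
  assumes "odd_parts xs"
  shows "const_term (half_deriv_part xs f) = of_nat (z_stat xs) / 2 ^ length xs * Poly_Mapping.lookup f (part_exp xs)"
  using assms
proof (induction xs arbitrary: f)
  case (Cons a xs)
  have a: "Poly_Mapping.lookup (part_exp xs) (a div 2) = count_list xs a"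
    using Cons.prems by (auto simp: lookup_part_exp elim!: oddE)
  have "const_term (half_deriv_part (a # xs) f) = const_term (half_deriv_part xs (half_deriv a f))"
    by (simp add: half_deriv_part_commute)
  also have "\<dots> = of_nat (z_stat xs) / 2 ^ length xs * (of_nat a / 2 * (of_nat (count_list xs a + 1) *
      Poly_Mapping.lookup f (part_exp xs + var_exp a)))"
    using Cons by (simp only: odd_parts_simps lookup_half_deriv a)
  finally show ?case
    by (simp only: z_stat_Cons part_exp_simps add.commute[of "var_exp a"] length_Cons power_Suc of_nat_mult)
      (simp add: mult_ac)
qed simp

lemma half_deriv_part_mset:
  assumes "mset xs = mset ys"
  shows "half_deriv_part xs = half_deriv_part ys"
proof -
  have "foldr half_deriv xs = foldr half_deriv ys"
    unfolding foldr_conv_fold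
    using assms by (intro fold_multiset_equiv) (auto simp: half_deriv_commute fun_eq_iff)
  thus ?thesis by (simp add: half_deriv_part_def fun_eq_iff)
qed

text \<open>Each \<open>half_deriv a\<close> either lowers the mode by \<open>a\<close> or passes on
  to \<open>f\<close>; \<open>I\<close> is the set of positions that pass on. Hence subpartitions
  are counted by index sets.\<close>

lemma half_deriv_part_vertex_op:
  assumes "odd_parts mu"
  shows "half_deriv_part mu (vertex_op c k f) =
    (\<Sum>I\<in>Pow {..<length mu}. vertex_op c (k - int (sum_list mu) + int (sum_list (nths mu I))) (half_deriv_part (nths mu I) f))"
  using assms
proof (induction mu arbitrary: k f rule: rev_induct)
  case (snoc a mu)
  let ?n = "length mu"
  let ?t = "\<lambda>I. vertex_op c (k - int (sum_list (mu @ [a])) + int (sum_list (nths (mu @ [a]) I))) (half_deriv_part (nths (mu @ [a]) I) f)"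
  \<comment> \<open>Subsets of the longer index range are split by whether they contain the last
    position \<open>?n\<close>.\<close>
  have P: "Pow {..<length (mu @ [a])} = Pow {..<?n} \<union> insert ?n ` Pow {..<?n}"
    by (simp add: lessThan_Suc Pow_insert)
  have n: "nths (mu @ [a]) I = nths mu I" "nths (mu @ [a]) (insert ?n I) = nths mu I @ [a]" if "I \<in> Pow {..<?n}" for I
  proof -
    have "nths mu (insert ?n I) = nths mu I"
      by (simp add: nths_def) (rule arg_cong[where f = "map fst"], rule filter_cong, auto simp: set_zip)
    moreover have "?n \<notin> I" using that by auto
    ultimately show "nths (mu @ [a]) I = nths mu I" "nths (mu @ [a]) (insert ?n I) = nths mu I @ [a]"
      by (simp_all add: nths_append)
  qed
  have "(\<Sum>I\<in>Pow {..<length (mu @ [a])}. ?t I) = (\<Sum>I\<in>Pow {..<?n}. ?t I) + (\<Sum>I\<in>insert ?n ` Pow {..<?n}. ?t I)"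
    unfolding P by (rule sum.union_disjoint) auto
  also have "(\<Sum>I\<in>insert ?n ` Pow {..<?n}. ?t I) = (\<Sum>I\<in>Pow {..<?n}. ?t (insert ?n I))"
  proof (rule sum.reindex_cong)
    show "inj_on (insert ?n) (Pow {..<?n})"
    proof (rule inj_onI)
      fix I J assume IJ: "I \<in> Pow {..<?n}" "J \<in> Pow {..<?n}" "insert ?n I = insert ?n J"
      hence "?n \<notin> I" "?n \<notin> J" by auto
      with IJ(3) show "I = J" by (metis insert_ident)
    qed
  qed auto
  also have "(\<Sum>I\<in>Pow {..<?n}. ?t I) = half_deriv_part mu (vertex_op c (k - int a) f)"
    using snoc by (simp add: n algebra_simps)
  also have "(\<Sum>I\<in>Pow {..<?n}. ?t (insert ?n I)) = half_deriv_part mu (vertex_op c k (half_deriv a f))"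
    using snoc by (simp add: n algebra_simps half_deriv_part_append)
  finally show ?case using snoc.prems
    by (simp add: half_deriv_part_append half_deriv_vertex_op half_deriv_part_add)
qed simp

lemma const_term_psum_mult [simp]: "const_term (psum a * f) = 0"
  by (simp add: lookup_psum_mult_0)

text \<open>For \<open>k > 0\<close> every summand of \<open>creation_rec\<close> has a factor
  \<open>p_a\<close> and so no constant term.\<close>

lemma const_term_creation: "const_term (creation k) = (if k = 0 then 1 else 0)"
proof (cases "k > 0")
  case True
  have "of_int k * const_term (creation k) = const_term (of_int k * creation k)"
    using True by (cases k rule: int_cases2) (auto simp flip: scalar_of_nat)
  also have "\<dots> = const_term (\<Sum>a\<in>{a. odd a \<and> int a \<le> k}. psum a * (2 * creation (k - int a)))"
    unfolding creation_rec by (simp only: mult_ac)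
  also have "\<dots> = 0" by (simp only: lookup_sum const_term_psum_mult sum.neutral_const)
  finally show ?thesis using True by simp
next
  case False
  thus ?thesis by (cases "k = 0") (simp_all add: creation_neg)
qed

definition part_prod :: "(nat \<Rightarrow> ratfun) \<Rightarrow> partition \<Rightarrow> ratfun" where
  "part_prod c xs = prod_list (map c xs)"

text \<open>Of the two terms of \<open>vertex_op_psum\<close> only the one absorbing
  \<open>p_a\<close> into the mode keeps a constant term; it contributes \<open>c a\<close> and
  raises the mode by \<open>a\<close>.\<close>

lemma const_term_vertex_op_psum_part:
  assumes "odd_parts rho"
  shows "const_term (vertex_op c k (psum_part rho)) = (if k + int (sum_list rho) = 0 then part_prod c rho else 0)"
  using assms
proof (induction rho arbitrary: k)
  case Nil
  show ?case by (simp add: vertex_op_1 const_term_creation part_prod_def)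
next
  case (Cons a rho)
  thus ?case by (simp add: vertex_op_psum lookup_add part_prod_def add.assoc)
qed

text \<open>By linearity it suffices to treat monomials; those of weight different from
  \<open>- k\<close> contribute nothing.\<close>

lemma const_term_vertex_op:
  "const_term (vertex_op c k g) =
     (if k \<le> 0 then (\<Sum>rho\<in>OP (nat (- k)). part_prod c rho * Poly_Mapping.lookup g (part_exp rho)) else 0)"
proof -
  let ?h = "\<lambda>m. Poly_Mapping.lookup g m * const_term (vertex_op c k (Poly_Mapping.single m 1))"
  have e: "const_term (vertex_op c k g) = (\<Sum>m\<in>Poly_Mapping.keys g. ?h m)"
    by (subst gamma_monomials[of g]) (simp only: vertex_op_sum vertex_op_scalar lookup_sum lookup_scalar_mult)
  have h: "?h (part_exp rho) = (if k + int (sum_list rho) = 0 then part_prod c rho * Poly_Mapping.lookup g (part_exp rho) else 0)"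
    if "odd_parts rho" for rho
    using that by (simp add: const_term_vertex_op_psum_part flip: psum_part_eq)
  show ?thesis
  proof (cases "k \<le> 0")
    case False
    have "?h m = 0" for m using False by (rule_tac part_exp_surj[of m]) (simp only: h, simp)
    hence "(\<Sum>m\<in>Poly_Mapping.keys g. ?h m) = 0" by (intro sum.neutral) blast
    thus ?thesis using False by (simp only: e if_False)
  next
    case True
    let ?A = "part_exp ` OP (nat (- k))"
    have z: "?h m = 0" if "m \<notin> ?A" for m
    proof -
      obtain xs where xs: "is_partition xs" "odd_parts xs" "m = part_exp xs" by (rule part_exp_surj)
      hence "k + int (sum_list xs) \<noteq> 0" using that by (auto simp: OP_iff)
      thus ?thesis using xs by (simp only: h if_False)
    qed
    have "(\<Sum>m\<in>Poly_Mapping.keys g. ?h m) = (\<Sum>m\<in>Poly_Mapping.keys g \<union> ?A. ?h m)"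
      by (rule sum.mono_neutral_left) (auto simp: in_keys_iff)
    also have "\<dots> = (\<Sum>m\<in>?A. ?h m)"
      using z by (intro sum.mono_neutral_right) auto
    also have "\<dots> = (\<Sum>rho\<in>OP (nat (- k)). ?h (part_exp rho))"
      by (rule sum.reindex_cong[of part_exp]) (auto simp: inj_on_def OP_iff intro: part_exp_inj)
    also have "\<dots> = (\<Sum>rho\<in>OP (nat (- k)). part_prod c rho * Poly_Mapping.lookup g (part_exp rho))"
      using True by (intro sum.cong refl) (auto simp: OP_iff h)
    finally show ?thesis using True e by simp
  qed
qed

lemma lookup_part_exp_eq:
  assumes "odd_parts xs"
  shows "Poly_Mapping.lookup f (part_exp xs) = 2 ^ length xs / of_nat (z_stat xs) * const_term (half_deriv_part xs f)"
  using z_stat_pos[OF odd_parts_0[OF assms]] by (simp add: const_term_half_deriv_part[OF assms])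

lemma half_deriv_part_0 [simp]: "half_deriv_part xs 0 = 0"
  by (induction xs) simp_all

lemma half_deriv_part_1: "half_deriv_part xs 1 = (if xs = [] then 1 else 0)"
  by (cases xs) (simp_all flip: half_deriv_part_commute)

lemma half_deriv_part_creation:
  "odd_parts xs \<Longrightarrow> half_deriv_part xs (creation k) = creation (k - int (sum_list xs))"
  by (induction xs) (simp_all add: half_deriv_creation algebra_simps)

section \<open>The coefficients \<open>green\<close> and their recursion\<close>

definition vertex_fun :: "(nat \<Rightarrow> ratfun) \<Rightarrow> partition \<Rightarrow> gamma" where
  "vertex_fun c xs = foldr (\<lambda>k. vertex_op c (int k)) xs 1"

lemma vertex_fun_simps [simp]:
  "vertex_fun c [] = 1" "vertex_fun c (k # xs) = vertex_op c (int k) (vertex_fun c xs)"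
  by (simp_all add: vertex_fun_def)

lemma G_fun_eq: "G_fun = vertex_fun (\<lambda>n. tvar ^ n - 1)"
  by (simp add: fun_eq_iff G_fun_def vertex_fun_def G_op_def)

lemma Q_fun_eq: "Q_fun = vertex_fun (\<lambda>n. - 1)"
  by (simp add: fun_eq_iff Q_fun_def vertex_fun_def Q_op_def)

text \<open>For \<open>c\<^sub>n = t\<^sup>n - 1\<close> this is \<open>Y\<^sup>\<lambda>\<^sub>\<mu>(t)\<close>, for \<open>c\<^sub>n = -1\<close> it is \<open>Y\<^sup>\<lambda>\<^sub>\<mu>(0)\<close>.\<close>

definition green :: "(nat \<Rightarrow> ratfun) \<Rightarrow> partition \<Rightarrow> partition \<Rightarrow> ratfun" where
  "green c lam mu = const_term (half_deriv_part mu (vertex_fun c lam))"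

lemma green_mset: "mset mu = mset nu \<Longrightarrow> green c lam mu = green c lam nu"
  unfolding green_def using half_deriv_part_mset[of mu nu] by simp

lemma green_Nil: "green c [] mu = (if mu = [] then 1 else 0)"
  by (simp add: green_def half_deriv_part_1)

lemma lookup_vertex_fun:
  "odd_parts xs \<Longrightarrow>
    Poly_Mapping.lookup (vertex_fun c lam) (part_exp xs) = 2 ^ length xs / of_nat (z_stat xs) * green c lam xs"
  by (simp only: lookup_part_exp_eq green_def)

text \<open>For \<open>c n = t^n - 1\<close> this is \<open>(-2)^l(rho) / z_rho(t)\<close>, see
  \<open>part_weight_tvar\<close>.\<close>

definition part_weight :: "(nat \<Rightarrow> ratfun) \<Rightarrow> partition \<Rightarrow> ratfun" where
  "part_weight c rho = part_prod c rho * (2 ^ length rho / of_nat (z_stat rho))"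

lemma const_term_vertex_op':
  "const_term (vertex_op c k g) =
     (if k \<le> 0 then (\<Sum>rho\<in>OP (nat (- k)). part_weight c rho * const_term (half_deriv_part rho g)) else 0)"
  unfolding const_term_vertex_op part_weight_def
  by (intro if_cong sum.cong refl) (simp add: OP_iff lookup_part_exp_eq)

text \<open>After \<open>half_deriv_part_vertex_op\<close> the mode has index
  \<open>k - |mu| + |nu|\<close> for the subpartition \<open>nu\<close> that passed on; its constant
  term needs an odd partition \<open>rho\<close> of the opposite weight.\<close>

lemma green_Cons:
  assumes "odd_parts mu"
  shows "green c (k # lam) mu = (\<Sum>I\<in>Pow {..<length mu}.
     if k + sum_list (nths mu I) \<le> sum_list mu
     then (\<Sum>rho\<in>OP (sum_list mu - k - sum_list (nths mu I)). part_weight c rho * green c lam (rho @ nths mu I))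
     else 0)"
proof -
  have e: "nat (- (int k - int (sum_list mu) + int s)) = sum_list mu - k - s" for s by simp
  have l: "int k - int (sum_list mu) + int s \<le> 0 \<longleftrightarrow> k + s \<le> sum_list mu" for s by linarith
  show ?thesis
    unfolding green_def vertex_fun_simps half_deriv_part_vertex_op[OF assms] lookup_sum const_term_vertex_op' e l
      half_deriv_part_append ..
qed

text \<open>In the recursion \<open>rho\<close> and the subpartition together weigh
  \<open>sum_list mu - k\<close>, so a mismatch of weights persists down to the vacuum.\<close>

lemma green_homogeneous:
  assumes "odd_parts mu" "sum_list mu \<noteq> sum_list lam"
  shows "green c lam mu = 0"
  using assms
proof (induction lam arbitrary: mu)
  case Nil
  thus ?case by (auto simp: green_Nil)
next
  case (Cons k lam)
  have "part_weight c rho * green c lam (rho @ nths mu I) = 0"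
    if "k + sum_list (nths mu I) \<le> sum_list mu" "rho \<in> OP (sum_list mu - k - sum_list (nths mu I))" for I rho
  proof -
    have "sum_list (rho @ nths mu I) = sum_list mu - k" using that by (auto simp: OP_iff)
    hence "green c lam (rho @ nths mu I) = 0"
      using that Cons.prems by (intro Cons.IH) (auto simp: OP_iff odd_parts_nths)
    thus ?thesis by simp
  qed
  thus ?case unfolding green_Cons[OF Cons.prems(1)] by (intro sum.neutral ballI) (auto intro!: sum.neutral)
qed

lemma finite_sub_index_sets [simp]: "finite (sub_index_sets mu i)"
  by (rule finite_subset[of _ "Pow {..<length mu}"]) (auto simp: sub_index_sets_def)

text \<open>Index sets are grouped by the weight \<open>i\<close> of their subpartition; weights
  above \<open>sum_list lam\<close> leave no room for \<open>rho\<close>.\<close>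

lemma green_rec:
  assumes "odd_parts mu" "sum_list mu = k + sum_list lam"
  shows "green c (k # lam) mu = (\<Sum>i=0..sum_list lam. \<Sum>I\<in>sub_index_sets mu i.
     \<Sum>rho\<in>OP (sum_list lam - i). part_weight c rho * green c lam (rho @ nths mu I))"
proof -
  let ?w = "\<lambda>I. sum_list (nths mu I)" and ?m = "sum_list lam"
  let ?f = "\<lambda>I. \<Sum>rho\<in>OP (?m - ?w I). part_weight c rho * green c lam (rho @ nths mu I)"
  let ?S = "{I. I \<subseteq> {..<length mu} \<and> ?w I \<le> ?m}"
  have "green c (k # lam) mu = (\<Sum>I\<in>Pow {..<length mu}. if ?w I \<le> ?m then ?f I else 0)"
    unfolding green_Cons[OF assms(1)] using assms(2) by (simp cong: if_cong)
  also have "\<dots> = (\<Sum>I\<in>?S. ?f I)"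
    by (rule sum.mono_neutral_cong_right) auto
  also have "\<dots> = (\<Sum>i\<in>{0..?m}. \<Sum>I\<in>{I \<in> ?S. ?w I = i}. ?f I)"
    by (rule sum.group[symmetric]) auto
  also have "\<dots> = (\<Sum>i=0..?m. \<Sum>I\<in>sub_index_sets mu i. \<Sum>rho\<in>OP (?m - i). part_weight c rho * green c lam (rho @ nths mu I))"
    by (intro sum.cong refl) (auto simp: sub_index_sets_def)
  finally show ?thesis .
qed

section \<open>Total weights of odd partitions\<close>

definition weight_sum :: "(nat \<Rightarrow> ratfun) \<Rightarrow> nat \<Rightarrow> ratfun" where
  "weight_sum c m = (\<Sum>rho\<in>OP m. part_weight c rho)"

text \<open>\<open>half_deriv_part rho\<close> lowers the index of \<open>creation m\<close> by
  \<open>|rho|\<close>, and only index 0 leaves a constant term, namely 1. So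
  \<open>weight_sum\<close> is a matrix coefficient of a mode.\<close>

lemma const_term_vertex_op_creation:
  "const_term (vertex_op c k (creation m)) = (if k = - m \<and> m \<ge> 0 then weight_sum c (nat m) else 0)"
proof (cases "k \<le> 0")
  case True
  have "const_term (half_deriv_part rho (creation m)) = (if k = - m then 1 else 0)" if "rho \<in> OP (nat (- k))" for rho
    using that True by (auto simp: OP_iff half_deriv_part_creation const_term_creation)
  hence "const_term (vertex_op c k (creation m)) = (\<Sum>rho\<in>OP (nat (- k)). part_weight c rho * (if k = - m then 1 else 0))"
    unfolding const_term_vertex_op' using True by simp
  thus ?thesis using True by (auto simp: weight_sum_def)
next
  case False
  thus ?thesis by (auto simp: const_term_vertex_op')
qed

text \<open>Mode \<open>- m\<close> is applied to both sides of \<open>creation_rec\<close>; each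
  \<open>p_a\<close> is absorbed at the cost of \<open>c a\<close>. The result is the Euler
  recursion for \<open>exp (\<Sum> (2/a) c_a z^a)\<close>.\<close>

lemma weight_sum_rec:
  "of_nat m * weight_sum c m = (\<Sum>a\<in>{a. odd a \<and> a \<le> m}. 2 * c a * weight_sum c (m - a))"
proof -
  let ?v = "\<lambda>a. const_term (vertex_op c (- int m + int a) (creation (int m - int a)))"
  have eq: "{a. odd a \<and> int a \<le> int m} = {a. odd a \<and> a \<le> m}" by simp
  have "of_nat m * weight_sum c m = const_term (vertex_op c (- int m) (scalar (of_nat m) * creation (int m)))"
    by (simp add: vertex_op_scalar const_term_vertex_op_creation)
  also have "scalar (of_nat m) * creation (int m) = (\<Sum>a\<in>{a. odd a \<and> a \<le> m}. scalar 2 * (psum a * creation (int m - int a)))"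
    using creation_rec[of "int m"] scalar_of_nat[of 2] by (simp add: scalar_of_nat eq mult.assoc)
  also have "const_term (vertex_op c (- int m) \<dots>) = (\<Sum>a\<in>{a. odd a \<and> a \<le> m}. 2 * (c a * ?v a))"
    unfolding vertex_op_sum lookup_sum vertex_op_scalar lookup_scalar_mult
    by (intro sum.cong refl) (simp add: vertex_op_psum lookup_add)
  also have "\<dots> = (\<Sum>a\<in>{a. odd a \<and> a \<le> m}. 2 * c a * weight_sum c (m - a))"
    by (intro sum.cong refl) (simp add: const_term_vertex_op_creation nat_diff_distrib)
  finally show ?thesis .
qed

lemma OP_0 [simp]: "OP 0 = {[]}"
proof -
  have "xs = []" if "xs \<in> OP 0" for xs
    using that by (cases xs) (auto simp: OP_iff)
  thus ?thesis by (auto simp: OP_iff is_partition_def)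
qed

lemma weight_sum_0 [simp]: "weight_sum c 0 = 1"
  by (simp add: weight_sum_def part_weight_def part_prod_def)

section \<open>Identification with the spin Green polynomials\<close>

lemma lookup_psum_part_sum:
  assumes "is_partition xs" "odd_parts xs"
  shows "Poly_Mapping.lookup (\<Sum>mu\<in>OP n. scalar (a mu) * psum_part mu) (part_exp xs) =
     (if sum_list xs = n then a xs else 0)"
proof -
  have "Poly_Mapping.lookup (\<Sum>mu\<in>OP n. scalar (a mu) * psum_part mu) (part_exp xs) =
        (\<Sum>mu\<in>OP n. if mu = xs then a mu else 0)"
    unfolding lookup_sum
  proof (intro sum.cong refl)
    fix mu assume "mu \<in> OP n"
    hence "part_exp mu = part_exp xs \<longleftrightarrow> mu = xs"
      using assms by (auto simp: OP_iff intro: part_exp_inj)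
    thus "Poly_Mapping.lookup (scalar (a mu) * psum_part mu) (part_exp xs) = (if mu = xs then a mu else 0)"
      by (simp add: psum_part_eq lookup_single when_def)
  qed
  thus ?thesis using assms by (auto simp: OP_iff)
qed

lemma psum_part_expansion:
  "vertex_fun c lam = (\<Sum>mu\<in>OP (sum_list lam).
     scalar (inverse (of_nat (z_stat mu)) * 2 ^ length mu * green c lam mu) * psum_part mu)"
proof (rule poly_mapping_eqI)
  fix m
  obtain xs where xs: "is_partition xs" "odd_parts xs" "m = part_exp xs" by (rule part_exp_surj)
  show "Poly_Mapping.lookup (vertex_fun c lam) m = Poly_Mapping.lookup (\<Sum>mu\<in>OP (sum_list lam).
     scalar (inverse (of_nat (z_stat mu)) * 2 ^ length mu * green c lam mu) * psum_part mu) m"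
    unfolding xs(3) lookup_psum_part_sum[OF xs(1,2)] lookup_vertex_fun[OF xs(2)]
    using xs(2) by (auto simp: green_homogeneous divide_simps)
qed

text \<open>The factors \<open>2^l(mu) / z_mu\<close> are nonzero and distinct odd partitions give
  distinct monomials, so the coefficients of \<open>G_fun lam\<close> determine \<open>Y\<close>.
  The definite description is therefore \<open>green\<close>, cut off outside
  \<open>OP\<close>.\<close>

lemma spin_Green_eq:
  assumes "mu \<in> OP (sum_list lam)"
  shows "spin_Green lam mu = green (\<lambda>n. tvar ^ n - 1) lam mu"
proof -
  let ?c = "\<lambda>n. tvar ^ n - 1" and ?n = "sum_list lam"
  let ?Y = "\<lambda>mu. if mu \<in> OP ?n then green ?c lam mu else 0"
  have "spin_Green lam = ?Y"
    unfolding spin_Green_def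
  proof (rule the_equality)
    show "(\<forall>mu. mu \<notin> OP ?n \<longrightarrow> ?Y mu = 0) \<and> G_fun lam =
       (\<Sum>mu\<in>OP ?n. scalar (inverse (of_nat (z_stat mu)) * 2 ^ length mu * ?Y mu) * psum_part mu)"
      unfolding G_fun_eq by (subst psum_part_expansion) simp
  next
    fix Y
    assume Y: "(\<forall>mu. mu \<notin> OP ?n \<longrightarrow> Y mu = 0) \<and> G_fun lam =
       (\<Sum>mu\<in>OP ?n. scalar (inverse (of_nat (z_stat mu)) * 2 ^ length mu * Y mu) * psum_part mu)"
    show "Y = ?Y"
    proof
      fix mu
      show "Y mu = ?Y mu"
      proof (cases "mu \<in> OP ?n")
        case True
        hence mu: "is_partition mu" "odd_parts mu" "sum_list mu = ?n" by (auto simp: OP_iff)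
        have "inverse (of_nat (z_stat mu)) * 2 ^ length mu * Y mu = Poly_Mapping.lookup (G_fun lam) (part_exp mu)"
          using Y mu by (simp only: lookup_psum_part_sum simp_thms if_True)
        also have "\<dots> = inverse (of_nat (z_stat mu)) * 2 ^ length mu * green ?c lam mu"
          unfolding G_fun_eq lookup_vertex_fun[OF mu(2)] by (simp add: field_simps)
        finally show ?thesis using True z_stat_pos[OF odd_parts_0[OF mu(2)]] by simp
      qed (use Y in simp)
    qed
  qed
  thus ?thesis using assms by simp
qed

section \<open>Closed forms, degrees and two-row partitions\<close>

lemma sum_odd_even: "(\<Sum>a\<in>{a. odd a \<and> a \<le> 2 * h}. f a) = (\<Sum>j<h. f (2 * j + 1))"
  and sum_odd_odd: "(\<Sum>a\<in>{a. odd a \<and> a \<le> 2 * h + 1}. f a) = (\<Sum>j<h. f (2 * j + 1)) + f (2 * h + 1)"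
  for f :: "nat \<Rightarrow> 'a :: comm_monoid_add"
proof -
  have *: "(\<Sum>a\<in>{a. odd a \<and> a \<le> 2 * h}. f a) = (\<Sum>j<h. f (2 * j + 1))" for h
  proof (rule sum.reindex_cong)
    show "{a. odd a \<and> a \<le> 2 * h} = (\<lambda>j. 2 * j + 1) ` {..<h}"
    proof (intro equalityI subsetI)
      fix a assume a: "a \<in> {a. odd a \<and> a \<le> 2 * h}"
      then obtain j where "a = 2 * j + 1" by (auto elim: oddE)
      thus "a \<in> (\<lambda>j. 2 * j + 1) ` {..<h}" using a by auto
    qed auto
  qed (auto simp: inj_on_def)
  show "(\<Sum>a\<in>{a. odd a \<and> a \<le> 2 * h}. f a) = (\<Sum>j<h. f (2 * j + 1))" by (rule *)
  have "{a. odd a \<and> a \<le> 2 * h + 1} = insert (2 * h + 1) {a. odd a \<and> a \<le> 2 * h}"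
    by (auto simp: le_Suc_eq)
  thus "(\<Sum>a\<in>{a. odd a \<and> a \<le> 2 * h + 1}. f a) = (\<Sum>j<h. f (2 * j + 1)) + f (2 * h + 1)"
    using *[of h] by (simp add: add.commute)
qed

text \<open>A geometric sum in \<open>x^2\<close> and \<open>y^2\<close>, telescoped by induction
  without division.\<close>

lemma sum_mixed_powers:
  "(x ^ 2 - y ^ 2) * (\<Sum>j<h. x ^ (2 * j + 1) * y ^ (2 * (h - j))) = x * y ^ 2 * (x ^ (2 * h) - y ^ (2 * h))"
  for x y :: "'a :: comm_ring_1"
proof (induction h)
  case (Suc h)
  have "(\<Sum>j<Suc h. x ^ (2 * j + 1) * y ^ (2 * (Suc h - j))) =
     y ^ 2 * (\<Sum>j<h. x ^ (2 * j + 1) * y ^ (2 * (h - j))) + x ^ (2 * h + 1) * y ^ 2"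
    by (simp add: sum_distrib_left Suc_diff_le power_add algebra_simps power2_eq_square)
  hence "(x ^ 2 - y ^ 2) * (\<Sum>j<Suc h. x ^ (2 * j + 1) * y ^ (2 * (Suc h - j))) =
     y ^ 2 * ((x ^ 2 - y ^ 2) * (\<Sum>j<h. x ^ (2 * j + 1) * y ^ (2 * (h - j)))) + (x ^ 2 - y ^ 2) * (x ^ (2 * h + 1) * y ^ 2)"
    by (simp only: distrib_left mult.left_commute)
  also have "\<dots> = x * y ^ 2 * (x ^ (2 * Suc h) - y ^ (2 * Suc h))"
    unfolding Suc.IH by (simp add: algebra_simps power2_eq_square)
  finally show ?case .
qed simp

text \<open>Here \<open>p, r\<close> are the powers \<open>x^a, y^a\<close> and \<open>q, s\<close>
  those with exponent \<open>m - a\<close>. The first identity serves even \<open>m\<close>, the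
  second odd \<open>m\<close>; the inner bracket on the right isolates the cross terms.\<close>

lemma mixed_product_minus: "2 * (p - r) * (k * (q + s)) = 2 * k * (p * q - r * s + (p * s - q * r))"
  and mixed_product_plus: "2 * (p - r) * (k * (q - s)) = 2 * k * (p * q + r * s - (p * s + r * q))"
  for p q r s k :: "'a :: comm_ring_1"
  by (simp_all add: algebra_simps)

text \<open>The final step of \<open>weight_sum_closed\<close> for odd \<open>m = 2h + 1\<close>,
  with \<open>X = x^(2h)\<close>, \<open>Y = y^(2h)\<close> and \<open>S\<close> the sum of the
  cross terms. The factor \<open>x + y\<close> clears the denominator of \<open>K\<close>.\<close>

lemma odd_weight_identity:
  fixes x y :: "'a :: comm_ring_1"
  assumes K: "K * (x + y) = 2 * (x - y)" and S: "(x - y) * S = x * y * (X - Y)"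
  shows "(x + y) * (2 * K * (h * (x * X + y * Y) - S) + 2 * (x * X - y * Y)) =
         (x + y) * ((2 * h + 1) * (K * (x * X + y * Y)))"
proof -
  have "(x + y) * (2 * K * (h * (x * X + y * Y) - S) + 2 * (x * X - y * Y)) =
      2 * (K * (x + y)) * (h * (x * X + y * Y)) - 2 * (K * (x + y)) * S + 2 * (x + y) * (x * X - y * Y)"
    by (simp add: algebra_simps)
  also have "\<dots> = 2 * (2 * (x - y)) * (h * (x * X + y * Y)) - 4 * ((x - y) * S) + 2 * (x + y) * (x * X - y * Y)"
    unfolding K by (simp add: algebra_simps)
  also have "\<dots> = (2 * h + 1) * ((2 * (x - y)) * (x * X + y * Y))"
    unfolding S by (simp add: algebra_simps)
  also have "\<dots> = (x + y) * ((2 * h + 1) * (K * (x * X + y * Y)))"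
    unfolding K[symmetric] by (simp only: mult_ac)
  finally show ?thesis .
qed

text \<open>The generating function of \<open>weight_sum c\<close> is \<open>(1 + xz)(1 - yz) / ((1 - xz)(1 + yz))\<close>.\<close>

lemma weight_sum_closed:
  assumes c: "\<And>a. odd a \<Longrightarrow> c a = x ^ a - y ^ a" and xy: "x + y \<noteq> 0" and "m > 0"
  shows "weight_sum c m = 2 * (x - y) / (x + y) * (x ^ m - (- y) ^ m)"
  using \<open>m > 0\<close>
proof (induction m rule: less_induct)
  case (less m)
  define K where "K = 2 * (x - y) / (x + y)"
  have K: "K * (x + y) = 2 * (x - y)" using xy by (simp add: K_def)
  have "of_nat m * weight_sum c m = of_nat m * (K * (x ^ m - (- y) ^ m))"
  proof (cases "even m")
    case True
    then obtain h where m: "m = 2 * h" by auto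
    \<comment> \<open>The cross terms \<open>x^a y^(m - a)\<close> for \<open>a = 2j + 1\<close>.
      Reversing the order of \<open>j\<close> turns \<open>g j\<close> into
      \<open>g (h - Suc j)\<close>, so they cancel in the sum.\<close>
    define g where "g j = x ^ (2 * j + 1) * y ^ (2 * (h - Suc j) + 1)" for j
    have "2 * c (2 * j + 1) * weight_sum c (m - (2 * j + 1)) = 2 * K * ((x ^ m - y ^ m) + (g j - g (h - Suc j)))"
      if "j \<in> {..<h}" for j
    proof -
      have e: "m - (2 * j + 1) = 2 * (h - Suc j) + 1" "h - Suc (h - Suc j) = j" using that m by auto
      have p: "z ^ m = z ^ (2 * j + 1) * z ^ (2 * (h - Suc j) + 1)" for z :: ratfun
        unfolding power_add[symmetric] using that m by (intro arg_cong[where f = "(^) z"]) simp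
      have "weight_sum c (m - (2 * j + 1)) = K * (x ^ (2 * (h - Suc j) + 1) + y ^ (2 * (h - Suc j) + 1))"
        unfolding e K_def by (subst less.IH) (use that m in simp_all)
      moreover have "c (2 * j + 1) = x ^ (2 * j + 1) - y ^ (2 * j + 1)" by (rule c) simp
      ultimately show ?thesis unfolding g_def e p[of x] p[of y] by (simp only: mixed_product_minus)
    qed
    hence "of_nat m * weight_sum c m = (\<Sum>j<h. 2 * K * ((x ^ m - y ^ m) + (g j - g (h - Suc j))))"
      unfolding weight_sum_rec m sum_odd_even by (intro sum.cong) auto
    also have "\<dots> = 2 * K * (of_nat h * (x ^ m - y ^ m) + ((\<Sum>j<h. g j) - (\<Sum>j<h. g (h - Suc j))))"
      by (simp add: sum.distrib sum_subtractf flip: sum_distrib_left)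
    also have "(\<Sum>j<h. g (h - Suc j)) = (\<Sum>j<h. g j)" by (rule sum.nat_diff_reindex)
    finally show ?thesis using True by (simp add: m)
  next
    case False
    then obtain h where m: "m = 2 * h + 1" by (auto elim: oddE)
    \<comment> \<open>\<open>A\<close> and \<open>B\<close> collect the cross terms with the odd
      exponent on \<open>x\<close> and on \<open>y\<close>.\<close>
    define A where "A = (\<Sum>j<h. x ^ (2 * j + 1) * y ^ (2 * (h - j)))"
    define B where "B = (\<Sum>j<h. y ^ (2 * j + 1) * x ^ (2 * (h - j)))"
    define X where "X = x ^ (2 * h)"
    define Y where "Y = y ^ (2 * h)"
    have mm: "(of_nat m :: ratfun) = 2 * of_nat h + 1" by (simp add: m)
    have xm: "x ^ m = x * X" "y ^ m = y * Y" by (simp_all add: m X_def Y_def)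
    have AB: "(x ^ 2 - y ^ 2) * A = x * y ^ 2 * (X - Y)" "(y ^ 2 - x ^ 2) * B = y * x ^ 2 * (Y - X)"
      unfolding A_def B_def X_def Y_def by (rule sum_mixed_powers)+
    have "(x + y) * ((x - y) * (A + B)) = (x ^ 2 - y ^ 2) * A - (y ^ 2 - x ^ 2) * B"
      by (simp add: algebra_simps power2_eq_square)
    also have "\<dots> = (x + y) * (x * y * (X - Y))"
      unfolding AB by (simp add: algebra_simps power2_eq_square)
    finally have "(x + y) * ((x - y) * (A + B)) = (x + y) * (x * y * (X - Y))" .
    hence AB': "(x - y) * (A + B) = x * y * (X - Y)" using xy by simp
    have "2 * c (2 * j + 1) * weight_sum c (m - (2 * j + 1)) =
        2 * K * ((x ^ m + y ^ m) - (x ^ (2 * j + 1) * y ^ (2 * (h - j)) + y ^ (2 * j + 1) * x ^ (2 * (h - j))))"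
      if "j \<in> {..<h}" for j
    proof -
      have e: "m - (2 * j + 1) = 2 * (h - j)" using that m by auto
      have p: "z ^ m = z ^ (2 * j + 1) * z ^ (2 * (h - j))" for z :: ratfun
        unfolding power_add[symmetric] using that m by (intro arg_cong[where f = "(^) z"]) simp
      have "weight_sum c (m - (2 * j + 1)) = K * (x ^ (2 * (h - j)) - y ^ (2 * (h - j)))"
        unfolding e K_def by (subst less.IH) (use that m in simp_all)
      moreover have "c (2 * j + 1) = x ^ (2 * j + 1) - y ^ (2 * j + 1)" by (rule c) simp
      ultimately show ?thesis unfolding p[of x] p[of y] by (simp only: mixed_product_plus)
    qed
    hence S: "(\<Sum>j<h. 2 * c (2 * j + 1) * weight_sum c (m - (2 * j + 1))) = (\<Sum>j<h.
        2 * K * ((x ^ m + y ^ m) - (x ^ (2 * j + 1) * y ^ (2 * (h - j)) + y ^ (2 * j + 1) * x ^ (2 * (h - j)))))"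
      by (intro sum.cong refl)
    \<comment> \<open>The summand \<open>a = m\<close> stands apart: \<open>weight_sum c 0\<close>
      is 1, whereas the closed form would give 0.\<close>
    have "of_nat m * weight_sum c m = (\<Sum>j<h.
        2 * K * ((x ^ m + y ^ m) - (x ^ (2 * j + 1) * y ^ (2 * (h - j)) + y ^ (2 * j + 1) * x ^ (2 * (h - j))))) +
        2 * c m * weight_sum c 0"
      using weight_sum_rec[of m c] unfolding sum_odd_odd[of _ h, folded m] S by (simp only: diff_self_eq_0)
    also have "\<dots> = 2 * K * (of_nat h * (x ^ m + y ^ m) - (A + B)) + 2 * (x ^ m - y ^ m)"
      using False c[of m] by (simp add: sum.distrib sum_subtractf A_def B_def flip: sum_distrib_left)
    also have "2 * K * (of_nat h * (x ^ m + y ^ m) - (A + B)) + 2 * (x ^ m - y ^ m) = of_nat m * (K * (x ^ m + y ^ m))"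
    proof -
      have "(x + y) * (2 * K * (of_nat h * (x ^ m + y ^ m) - (A + B)) + 2 * (x ^ m - y ^ m)) =
            (x + y) * (of_nat m * (K * (x ^ m + y ^ m)))"
        using odd_weight_identity[OF K AB', of "of_nat h"] unfolding xm mm .
      thus ?thesis using xy by simp
    qed
    finally show ?thesis using False by simp
  qed
  hence "weight_sum c m = K * (x ^ m - (- y) ^ m)" using less.prems by simp
  thus ?case unfolding K_def .
qed

lemma tvar_plus_1 [simp]: "tvar + 1 \<noteq> 0"
proof -
  have "tvar + 1 = to_fract [:1, 1:]" by (simp add: tvar_def flip: to_fract_1 to_fract_add) (simp add: one_pCons)
  thus ?thesis by simp
qed

lemma weight_sum_tvar:
  "m > 0 \<Longrightarrow> weight_sum (\<lambda>n. tvar ^ n - 1) m = 2 * (tvar - 1) / (tvar + 1) * (tvar ^ m - (- 1) ^ m)"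
  by (rule weight_sum_closed) auto

text \<open>The closed form at \<open>x = 1\<close>, \<open>y = 0\<close>, used for leading
  coefficients in \<open>t\<close>.\<close>

lemma weight_sum_1:
  assumes "m > 0"
  shows "weight_sum (\<lambda>n. 1) m = 2"
proof -
  have "weight_sum (\<lambda>n. 1) m = 2 * (1 - 0) / (1 + 0) * (1 ^ m - (- 0) ^ m)"
    using assms by (intro weight_sum_closed) (auto simp: odd_pos)
  thus ?thesis using assms by simp
qed

text \<open>The closed form at \<open>x = 0\<close>, \<open>y = 1\<close>, the source of the
  Clifford constant.\<close>

lemma weight_sum_minus_1:
  assumes "m > 0"
  shows "weight_sum (\<lambda>n. - 1) m = 2 * (- 1) ^ m"
proof -
  have "weight_sum (\<lambda>n. - 1) m = 2 * (0 - 1) / (0 + 1) * (0 ^ m - (- 1) ^ m)"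
    using assms by (intro weight_sum_closed) (auto simp: odd_pos)
  thus ?thesis using assms by simp
qed

lemma prod_list_inverse: "prod_list (map (\<lambda>i. inverse (f i)) xs) = inverse (prod_list (map f xs))"
  for f :: "'a \<Rightarrow> 'b :: field"
  by (induction xs) simp_all

text \<open>Each factor \<open>t^a - 1 = - (1 - t^a)\<close> moves its sign into
  \<open>(-2)^l(rho)\<close>; \<open>z_stat_t\<close> holds the inverses of
  \<open>1 - t^a\<close>.\<close>

lemma part_weight_tvar: "part_weight (\<lambda>n. tvar ^ n - 1) rho = (- 2) ^ length rho / z_stat_t rho"
proof -
  have "(- 2) ^ length rho * prod_list (map (\<lambda>i. 1 - tvar ^ i) rho) =
        2 ^ length rho * prod_list (map (\<lambda>i. tvar ^ i - 1) rho)"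
  proof (induction rho)
    case (Cons a rho)
    have "(- 2) ^ length (a # rho) * prod_list (map (\<lambda>i. 1 - tvar ^ i) (a # rho)) =
      - 2 * (1 - tvar ^ a) * ((- 2) ^ length rho * prod_list (map (\<lambda>i. 1 - tvar ^ i) rho))"
      by (simp only: length_Cons power_Suc list.map prod_list.Cons mult_ac)
    also have "- 2 * (1 - tvar ^ a) = 2 * (tvar ^ a - 1)" by simp
    also have "2 * (tvar ^ a - 1) * ((- 2) ^ length rho * prod_list (map (\<lambda>i. 1 - tvar ^ i) rho)) =
      2 ^ length (a # rho) * prod_list (map (\<lambda>i. tvar ^ i - 1) (a # rho))"
      unfolding Cons.IH by (simp only: length_Cons power_Suc list.map prod_list.Cons mult_ac)
    finally show ?case .
  qed simp
  hence "2 ^ length rho * prod_list (map (\<lambda>i. tvar ^ i - 1) rho) / of_nat (z_stat rho) =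
      (- 2) ^ length rho * prod_list (map (\<lambda>i. 1 - tvar ^ i) rho) / of_nat (z_stat rho)" by simp
  also have "\<dots> = (- 2) ^ length rho / z_stat_t rho"
    unfolding z_stat_t_def prod_list_inverse by (simp add: divide_inverse)
  finally show ?thesis unfolding part_weight_def part_prod_def by (simp add: mult.commute)
qed

section \<open>Constants, polynomials and evaluation in the field of rational functions\<close>

lemma const_ratfun_0 [simp]: "const_ratfun 0 = 0" and const_ratfun_1 [simp]: "const_ratfun 1 = 1"
  by (simp_all add: const_ratfun_def flip: one_pCons)

lemma const_ratfun_add: "const_ratfun (a + b) = const_ratfun a + const_ratfun b"
  by (simp add: const_ratfun_def flip: to_fract_add)

lemma const_ratfun_mult: "const_ratfun (a * b) = const_ratfun a * const_ratfun b"
  by (simp add: const_ratfun_def flip: to_fract_mult)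

lemma const_ratfun_eq_iff [simp]: "const_ratfun a = const_ratfun b \<longleftrightarrow> a = b"
  by (simp add: const_ratfun_def)

lemma const_ratfun_uminus: "const_ratfun (- a) = - const_ratfun a"
  by (simp add: const_ratfun_def flip: to_fract_uminus)

lemma const_ratfun_of_nat: "const_ratfun (of_nat n) = of_nat n"
  by (induction n) (simp_all add: const_ratfun_add)

lemma const_ratfun_power: "const_ratfun (a ^ n) = const_ratfun a ^ n"
  by (induction n) (simp_all add: const_ratfun_mult)

lemma const_ratfun_divide: "const_ratfun (a / b) = const_ratfun a / const_ratfun b"
proof (cases "b = 0")
  case False
  hence "const_ratfun (a / b) * const_ratfun b = const_ratfun a" by (simp flip: const_ratfun_mult)
  moreover have "const_ratfun b \<noteq> 0" using False const_ratfun_eq_iff[of b 0] by simp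
  ultimately show ?thesis by (simp add: eq_divide_eq)
qed simp

lemma const_ratfun_sum: "const_ratfun (sum f A) = (\<Sum>x\<in>A. const_ratfun (f x))"
  by (induction A rule: infinite_finite_induct) (simp_all add: const_ratfun_add)

lemma const_ratfun_2: "const_ratfun 2 = 2"
  using const_ratfun_of_nat[of 2] by simp

lemma to_fract_smult: "to_fract (Polynomial.smult a p) = const_ratfun a * to_fract p"
  by (simp add: const_ratfun_def flip: to_fract_mult)

lemma to_fract_power: "to_fract (p ^ n) = to_fract p ^ n"
  by (induction n) simp_all

lemma to_fract_monom: "to_fract (monom a n) = const_ratfun a * tvar ^ n"
  unfolding monom_altdef to_fract_smult to_fract_power tvar_def ..

text \<open>If \<open>p/q\<close> is another representation of \<open>P\<close>, then
  \<open>P q = p\<close>, so the quotient of the values at \<open>a\<close> does not depend on the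
  choice.\<close>

lemma ratfun_at_to_fract: "ratfun_at (to_fract P) a = poly P a"
proof -
  have "c = poly P a" if "poly q a \<noteq> 0" "to_fract P = Fraction_Field.Fract p q" "c = poly p a / poly q a" for c p q
  proof -
    have "q \<noteq> 0" using that by auto
    hence "P * q = p" using that(2) by (simp add: to_fract_def eq_fract)
    thus ?thesis using that by auto
  qed
  moreover have "\<exists>p q. poly q a \<noteq> 0 \<and> to_fract P = Fraction_Field.Fract p q \<and> poly P a = poly p a / poly q a"
    by (intro exI[of _ P] exI[of _ 1]) (simp add: to_fract_def)
  ultimately show ?thesis unfolding ratfun_at_def by (intro the_equality) blast+
qed

section \<open>The recursion and the formulas for one and two rows\<close>

lemma green_one_row:
  assumes "odd_parts mu" "sum_list mu = n"
  shows "green c [n] mu = 1"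
  using assms by (simp add: green_def vertex_op_1 half_deriv_part_creation)

lemma mset_part_union: "mset (part_union xs ys) = mset xs + mset ys"
  by (simp add: part_union_def)

lemma sub_index_sets_iff: "I \<in> sub_index_sets mu i \<longleftrightarrow> I \<subseteq> {..<length mu} \<and> sum_list (nths mu I) = i"
  by (simp add: sub_index_sets_def)

lemma part_union_OP:
  assumes "odd_parts xs" "odd_parts ys" "sum_list xs + sum_list ys = n"
  shows "part_union xs ys \<in> OP n"
proof -
  have set: "set (part_union xs ys) = set (xs @ ys)" by (simp add: part_union_def)
  have "sum_list (part_union xs ys) = sum_list (xs @ ys)"
    unfolding sum_mset_sum_list[symmetric] mset_part_union mset_append ..
  moreover have "is_partition (part_union xs ys)"
    using odd_parts_0[OF assms(1)] odd_parts_0[OF assms(2)] by (simp add: part_union_def is_partition_rev_sort)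
  moreover have "odd_parts (part_union xs ys)"
    using assms(1,2) unfolding odd_parts_def set by auto
  ultimately show ?thesis using assms(3) by (simp add: OP_iff)
qed

text \<open>The list \<open>rho @ nths mu I\<close> need not be sorted. \<open>green_mset\<close>
  allows replacing it by \<open>part_union\<close>, which lies in \<open>OP\<close>, where
  \<open>green\<close> is the spin Green polynomial.\<close>

lemma spin_Green_rec:
  assumes "mu \<in> OP (k + sum_list lam)"
  shows "spin_Green (k # lam) mu =
       (\<Sum>i = 0..sum_list lam. \<Sum>I\<in>sub_index_sets mu i. \<Sum>rho\<in>OP (sum_list lam - i).
          (- 2) ^ length rho / z_stat_t rho * spin_Green lam (part_union (nths mu I) rho))"
proof -
  have mu: "odd_parts mu" "sum_list mu = k + sum_list lam" using assms by (auto simp: OP_iff)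
  show ?thesis
    unfolding spin_Green_eq[of mu "k # lam", unfolded sum_list.Cons, OF assms] green_rec[OF mu] part_weight_tvar
  proof (intro sum.cong refl)
    fix i I rho
    assume i: "i \<in> {0..sum_list lam}" and I: "I \<in> sub_index_sets mu i" and rho: "rho \<in> OP (sum_list lam - i)"
    hence "part_union (nths mu I) rho \<in> OP (sum_list lam)"
      using mu by (intro part_union_OP) (auto simp: odd_parts_nths OP_iff sub_index_sets_iff)
    moreover have "green c lam (rho @ nths mu I) = green c lam (part_union (nths mu I) rho)" for c
      by (rule green_mset) (simp add: mset_part_union)
    ultimately show "(- 2) ^ length rho / z_stat_t rho * green (\<lambda>n. tvar ^ n - 1) lam (rho @ nths mu I) =
       (- 2) ^ length rho / z_stat_t rho * spin_Green lam (part_union (nths mu I) rho)"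
      by (simp only: spin_Green_eq)
  qed
qed

lemma sum_list_nths: "sum_list (nths xs I) = (\<Sum>i<length xs. if i \<in> I then xs ! i else 0)"
  for xs :: "nat list"
proof (induction xs rule: rev_induct)
  case (snoc x xs)
  have "(\<Sum>i<length xs. if i \<in> I then (xs @ [x]) ! i else 0) = (\<Sum>i<length xs. if i \<in> I then xs ! i else 0)"
    by (intro sum.cong refl) (simp add: nth_append)
  thus ?case using snoc by (simp add: nths_append)
qed simp

text \<open>Complementation of index sets exchanges the weights \<open>i\<close> and
  \<open>sum_list mu - i\<close>.\<close>

lemma D_num_symmetric:
  assumes "i \<le> sum_list mu"
  shows "D_num mu (sum_list mu - i) = D_num mu i"
proof -
  have s: "sum_list (nths mu I) + sum_list (nths mu ({..<length mu} - I)) = sum_list mu" for I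
    unfolding sum_list_nths sum.distrib[symmetric] sum_list_sum_nth[of mu]
    by (intro sum.cong) (auto simp: atLeast0LessThan)
  have "bij_betw (\<lambda>I. {..<length mu} - I) (sub_index_sets mu (sum_list mu - i)) (sub_index_sets mu i)"
  proof (rule bij_betw_byWitness[where f' = "\<lambda>I. {..<length mu} - I"])
    show "(\<lambda>I. {..<length mu} - I) ` sub_index_sets mu (sum_list mu - i) \<subseteq> sub_index_sets mu i"
    proof safe
      fix I assume "I \<in> sub_index_sets mu (sum_list mu - i)"
      thus "{..<length mu} - I \<in> sub_index_sets mu i" using s[of I] assms by (auto simp: sub_index_sets_iff)
    qed
    show "(\<lambda>I. {..<length mu} - I) ` sub_index_sets mu i \<subseteq> sub_index_sets mu (sum_list mu - i)"
    proof safe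
      fix I assume "I \<in> sub_index_sets mu i"
      thus "{..<length mu} - I \<in> sub_index_sets mu (sum_list mu - i)" using s[of I] assms by (auto simp: sub_index_sets_iff)
    qed
  qed (auto simp: sub_index_sets_iff)
  thus ?thesis unfolding D_num_def by (rule bij_betw_same_card)
qed

text \<open>The shift leaves the coefficients \<open>D^(k+j)(mu)\<close>, and
  \<open>D_num_symmetric\<close> rewrites them as \<open>D^(m-j)(mu)\<close>, the form in which the
  recursion produces them.\<close>

lemma regular_part_D_poly:
  assumes "sum_list mu = k + m"
  shows "regular_part k (D_poly mu) = (\<Sum>i\<le>m. monom (of_nat (D_num mu i)) (m - i))"
proof (rule poly_eqI)
  fix j
  have "coeff (regular_part k (D_poly mu)) j = (if j \<le> m then of_nat (D_num mu (k + j)) else 0)"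
    using assms by (auto simp: regular_part_def coeff_poly_shift D_poly_def coeff_sum sum.delta add.commute cong: if_cong)
  also have "\<dots> = (if j \<le> m then of_nat (D_num mu (m - j)) else 0)"
  proof -
    have "D_num mu (k + j) = D_num mu (m - j)" if "j \<le> m"
      using D_num_symmetric[of "m - j" mu] assms that by (simp add: add.commute)
    thus ?thesis by simp
  qed
  also have "\<dots> = (\<Sum>i\<le>m. if i = m - j \<and> j \<le> m then of_nat (D_num mu i) else 0)"
    by (cases "j \<le> m") (simp_all add: sum.delta)
  also have "\<dots> = coeff (\<Sum>i\<le>m. monom (of_nat (D_num mu i)) (m - i)) j"
    unfolding coeff_sum by (intro sum.cong refl) auto
  finally show "coeff (regular_part k (D_poly mu)) j = coeff (\<Sum>i\<le>m. monom (of_nat (D_num mu i)) (m - i)) j" .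
qed

text \<open>By \<open>green_one_row\<close> the inner factor is 1, so the recursion becomes a sum of
  \<open>D^(i)(mu)\<close> times \<open>weight_sum\<close> at \<open>m - i\<close>. In the closed
  form the powers \<open>t^(m-i)\<close> give the regular part and \<open>(-1)^(m-i)\<close> its
  value at -1.\<close>

lemma spin_Green_two_rows:
  assumes "mu \<in> OP (k + m)"
  shows "spin_Green [k, m] mu = 2 * (tvar - 1) / (tvar + 1) *
            (to_fract (regular_part k (D_poly mu)) - const_ratfun (poly (regular_part k (D_poly mu)) (- 1)))
          + of_nat (D_num mu m)"
proof -
  let ?gc = "\<lambda>n. tvar ^ n - 1" and ?K = "2 * (tvar - 1) / (tvar + 1)"
  have mu: "odd_parts mu" "sum_list mu = k + m" using assms by (auto simp: OP_iff)
  have sum_eq: "(\<Sum>i\<in>{..m}. d i * (K * (a i - b i)) + (if i = m then d i else 0)) =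
      K * ((\<Sum>i\<le>m. d i * a i) - (\<Sum>i\<le>m. d i * b i)) + d m" for d a b :: "nat \<Rightarrow> ratfun" and K
    by (simp add: sum.distrib sum_subtractf sum_distrib_left right_diff_distrib mult.left_commute)
  have "spin_Green [k, m] mu = (\<Sum>i=0..m. \<Sum>I\<in>sub_index_sets mu i. \<Sum>rho\<in>OP (m - i). part_weight ?gc rho * green ?gc [m] (rho @ nths mu I))"
    using spin_Green_eq[of mu "[k, m]"] green_rec[of mu k "[m]" ?gc] assms mu by simp
  also have "\<dots> = (\<Sum>i\<in>{..m}. of_nat (D_num mu i) * weight_sum ?gc (m - i))"
  proof (rule sum.cong)
    fix i assume i: "i \<in> {..m}"
    have "(\<Sum>rho\<in>OP (m - i). part_weight ?gc rho * green ?gc [m] (rho @ nths mu I)) = weight_sum ?gc (m - i)"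
      if "I \<in> sub_index_sets mu i" for I
      unfolding weight_sum_def
    proof (rule sum.cong[OF refl])
      fix rho assume "rho \<in> OP (m - i)"
      hence "green ?gc [m] (rho @ nths mu I) = 1"
        using that mu i by (intro green_one_row) (auto simp: OP_iff sub_index_sets_iff odd_parts_nths)
      thus "part_weight ?gc rho * green ?gc [m] (rho @ nths mu I) = part_weight ?gc rho" by simp
    qed
    thus "(\<Sum>I\<in>sub_index_sets mu i. \<Sum>rho\<in>OP (m - i). part_weight ?gc rho * green ?gc [m] (rho @ nths mu I)) =
       of_nat (D_num mu i) * weight_sum ?gc (m - i)"
      by (simp add: D_num_def)
  qed auto
  \<comment> \<open>At \<open>i = m\<close> the closed form is 0 while the weight is 1; the second
    summand makes up for this and becomes \<open>D^(m)(mu)\<close>.\<close>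
  also have "\<dots> = (\<Sum>i\<in>{..m}. of_nat (D_num mu i) * (?K * (tvar ^ (m - i) - (- 1) ^ (m - i))) + (if i = m then of_nat (D_num mu i) else 0))"
  proof (rule sum.cong[OF refl])
    fix i assume "i \<in> {..m}"
    hence "i \<noteq> m \<Longrightarrow> weight_sum ?gc (m - i) = ?K * (tvar ^ (m - i) - (- 1) ^ (m - i))"
      by (intro weight_sum_tvar) simp
    thus "of_nat (D_num mu i) * weight_sum ?gc (m - i) = of_nat (D_num mu i) * (?K * (tvar ^ (m - i) - (- 1) ^ (m - i))) + (if i = m then of_nat (D_num mu i) else 0)"
      by (cases "i = m") (simp, simp only: if_False add_0_right not_False_eq_True simp_thms)
  qed
  also have "\<dots> = ?K * ((\<Sum>i\<le>m. of_nat (D_num mu i) * tvar ^ (m - i)) - (\<Sum>i\<le>m. of_nat (D_num mu i) * (- 1) ^ (m - i))) + of_nat (D_num mu m)"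
    by (rule sum_eq)
  also have "(\<Sum>i\<le>m. of_nat (D_num mu i) * tvar ^ (m - i)) = to_fract (regular_part k (D_poly mu))"
    unfolding regular_part_D_poly[OF mu(2)] to_fract_sum to_fract_monom const_ratfun_of_nat ..
  also have "(\<Sum>i\<le>m. of_nat (D_num mu i) * (- 1) ^ (m - i)) = const_ratfun (poly (regular_part k (D_poly mu)) (- 1))"
    unfolding regular_part_D_poly[OF mu(2)] poly_sum poly_monom const_ratfun_sum const_ratfun_mult const_ratfun_of_nat
      const_ratfun_power const_ratfun_uminus const_ratfun_1 ..
  finally show ?thesis .
qed

section \<open>Degree, leading coefficient and value at \<open>t = 0\<close>\<close>

lemma coeff_mult_bounds:
  fixes p q :: "'a :: comm_semiring_0 poly"
  assumes "degree p \<le> a" "degree q \<le> b"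
  shows "degree (p * q) \<le> a + b" and "coeff (p * q) (a + b) = coeff p a * coeff q b"
proof -
  show "degree (p * q) \<le> a + b" using degree_mult_le[of p q] assms by linarith
  show "coeff (p * q) (a + b) = coeff p a * coeff q b"
  proof (cases "degree p = a \<and> degree q = b")
    case True
    thus ?thesis using coeff_mult_degree_sum[of p q] by simp
  next
    case False
    hence "degree p < a \<or> degree q < b" using assms by auto
    moreover from this have "degree (p * q) < a + b" using degree_mult_le[of p q] assms by linarith
    ultimately show ?thesis by (auto simp: coeff_eq_0)
  qed
qed

text \<open>Since \<open>z_rho(t)\<close> is built from the inverses of \<open>1 - t^a\<close>,
  dividing by it gives a polynomial in \<open>t\<close>.\<close>

definition weight_poly :: "partition \<Rightarrow> complex poly" where
  "weight_poly rho = Polynomial.smult (2 ^ length rho / of_nat (z_stat rho)) (prod_list (map (\<lambda>a. monom 1 a - 1) rho))"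

lemma to_fract_weight_poly: "to_fract (weight_poly rho) = part_weight (\<lambda>n. tvar ^ n - 1) rho"
proof -
  have "to_fract (prod_list (map (\<lambda>a. monom 1 a - 1) rho)) = prod_list (map (\<lambda>a. tvar ^ a - 1) rho)"
    by (induction rho) (simp_all add: to_fract_monom)
  thus ?thesis
    by (simp add: weight_poly_def part_weight_def part_prod_def to_fract_smult const_ratfun_divide const_ratfun_power
        const_ratfun_2 const_ratfun_of_nat)
qed

lemma weight_poly_degree:
  assumes "odd_parts rho"
  shows "degree (weight_poly rho) \<le> sum_list rho"
    and "coeff (weight_poly rho) (sum_list rho) = 2 ^ length rho / of_nat (z_stat rho)"
proof -
  have "degree (prod_list (map (\<lambda>a. monom 1 a - 1) rho) :: complex poly) \<le> sum_list rho \<and>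
     coeff (prod_list (map (\<lambda>a. monom 1 a - 1) rho)) (sum_list rho) = (1 :: complex)"
    using assms
  proof (induction rho)
    case (Cons a rho)
    let ?p = "monom 1 a - 1 :: complex poly"
    have p: "degree ?p \<le> a" "coeff ?p a = 1"
      using Cons.prems by (auto simp: degree_diff_le degree_monom_le odd_pos)
    show ?case using coeff_mult_bounds[OF p(1) conjunct1[OF Cons.IH]] p(2) Cons by simp
  qed simp
  thus "degree (weight_poly rho) \<le> sum_list rho" "coeff (weight_poly rho) (sum_list rho) = 2 ^ length rho / of_nat (z_stat rho)"
    using degree_smult_le by (auto simp: weight_poly_def intro: order_trans)
qed

lemma weight_poly_at_0:
  assumes "odd_parts rho"
  shows "const_ratfun (poly (weight_poly rho) 0) = part_weight (\<lambda>n. - 1) rho"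
proof -
  have "poly (prod_list (map (\<lambda>a. monom 1 a - 1) rho)) 0 = (- 1 :: complex) ^ length rho"
    using assms by (induction rho) (auto simp: poly_monom zero_power odd_pos)
  moreover have "prod_list (map (\<lambda>n. - 1) rho) = (- 1 :: ratfun) ^ length rho"
    by (induction rho) simp_all
  ultimately show ?thesis
    by (simp add: weight_poly_def part_weight_def part_prod_def const_ratfun_mult const_ratfun_divide const_ratfun_power
        const_ratfun_2 const_ratfun_of_nat const_ratfun_uminus)
qed

text \<open>Without the first row every other part moves up by one. The difference
  \<open>sum_list lam\<close> is the largest degree of a weight in the recursion.\<close>

lemma n_stat_Cons: "n_stat (k # lam) = n_stat lam + sum_list lam"
proof -
  have "n_stat (k # lam) = (\<Sum>i<length lam. Suc i * lam ! i)"
    unfolding n_stat_def length_Cons sum.lessThan_Suc_shift by simp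
  also have "\<dots> = n_stat lam + (\<Sum>i<length lam. lam ! i)"
    by (simp add: n_stat_def sum.distrib add.commute)
  finally show ?thesis by (simp add: sum_list_sum_nth atLeast0LessThan)
qed

lemma sub_index_sets_0:
  assumes "odd_parts mu"
  shows "sub_index_sets mu 0 = {{}}"
proof -
  have "I = {}" if "I \<in> sub_index_sets mu 0" for I
  proof (rule ccontr)
    assume "I \<noteq> {}"
    then obtain i where "i \<in> I" by auto
    with that have i: "i \<in> I" "i < length mu" by (auto simp: sub_index_sets_iff)
    hence "mu ! i \<in> set (nths mu I)" by (auto simp: set_nths)
    moreover have "\<forall>x\<in>set (nths mu I). x = 0" using that by (simp add: sub_index_sets_iff)
    ultimately have "mu ! i = 0" by blast
    moreover have "odd (mu ! i)" using i assms by (simp add: odd_parts_def)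
    ultimately show False by simp
  qed
  moreover have "{} \<in> sub_index_sets mu 0" by (simp add: sub_index_sets_iff)
  ultimately show ?thesis by blast
qed

text \<open>The leading coefficients are the weights for \<open>c = 1\<close>; their total gives a
  factor 2 for each row beyond the first.\<close>

lemma sum_leading_weights: "m > 0 \<Longrightarrow> (\<Sum>rho\<in>OP m. 2 ^ length rho / of_nat (z_stat rho)) = (2 :: complex)"
proof -
  assume "m > 0"
  have p: "part_prod (\<lambda>n. 1) rho = 1" for rho by (induction rho) (simp_all add: part_prod_def)
  have "const_ratfun (\<Sum>rho\<in>OP m. 2 ^ length rho / of_nat (z_stat rho)) = weight_sum (\<lambda>n. 1) m"
    by (simp add: weight_sum_def part_weight_def p const_ratfun_sum const_ratfun_divide const_ratfun_power const_ratfun_2 const_ratfun_of_nat)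
  also have "\<dots> = const_ratfun 2" using \<open>m > 0\<close> by (simp add: weight_sum_1 const_ratfun_2)
  finally show ?thesis by simp
qed

text \<open>Induction over the rows by \<open>green_rec\<close>: one recursion builds the
  polynomial, bounds its degree, computes its top coefficient and, at \<open>t = 0\<close>, turns
  the weights for \<open>t^n - 1\<close> into those for \<open>- 1\<close>. A degree bound together
  with the coefficient at the bound can be handled termwise in sums.\<close>

lemma green_poly:
  assumes "odd_parts mu" "0 \<notin> set lam" "sum_list mu = sum_list lam"
  shows "\<exists>P. green (\<lambda>n. tvar ^ n - 1) lam mu = to_fract P \<and> degree P \<le> n_stat lam \<and>
     coeff P (n_stat lam) = 2 ^ (length lam - 1) \<and> const_ratfun (poly P 0) = green (\<lambda>n. - 1) lam mu"
  using assms
proof (induction lam arbitrary: mu)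
  case Nil
  thus ?case
    using odd_parts_0[of mu] by (intro exI[of _ 1]) (cases mu; auto simp: green_Nil n_stat_def)
next
  case (Cons k lam)
  let ?gc = "\<lambda>n. tvar ^ n - 1" and ?m = "sum_list lam"
  let ?Q = "\<lambda>nu P. green ?gc lam nu = to_fract P \<and> degree P \<le> n_stat lam \<and>
     coeff P (n_stat lam) = 2 ^ (length lam - 1) \<and> const_ratfun (poly P 0) = green (\<lambda>n. - 1) lam nu"
  have "\<forall>nu. \<exists>P. odd_parts nu \<and> sum_list nu = ?m \<longrightarrow> ?Q nu P"
    using Cons.IH Cons.prems by simp
  \<comment> \<open>The sum defining \<open>P\<close> needs a polynomial \<open>F nu\<close> chosen
    for all \<open>nu\<close> at once.\<close>
  from choice[OF this] obtain F where *: "\<forall>nu. odd_parts nu \<and> sum_list nu = ?m \<longrightarrow> ?Q nu (F nu)" ..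
  have F: "green ?gc lam nu = to_fract (F nu)" "degree (F nu) \<le> n_stat lam"
    "coeff (F nu) (n_stat lam) = 2 ^ (length lam - 1)" "const_ratfun (poly (F nu) 0) = green (\<lambda>n. - 1) lam nu"
    if "odd_parts nu" "sum_list nu = ?m" for nu
    using *[rule_format, OF conjI[OF that]] by blast+
  let ?t = "\<lambda>I rho. weight_poly rho * F (rho @ nths mu I)"
  define P where "P = (\<Sum>i=0..?m. \<Sum>I\<in>sub_index_sets mu i. \<Sum>rho\<in>OP (?m - i). ?t I rho)"
  have nu: "odd_parts (rho @ nths mu I)" "sum_list (rho @ nths mu I) = ?m" "odd_parts rho" "sum_list rho = ?m - i"
    if "i \<in> {0..?m}" "I \<in> sub_index_sets mu i" "rho \<in> OP (?m - i)" for i I rho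
    using that Cons.prems(1) by (auto simp: OP_iff sub_index_sets_iff odd_parts_nths)
  have rec: "green c (k # lam) mu = (\<Sum>i=0..?m. \<Sum>I\<in>sub_index_sets mu i. \<Sum>rho\<in>OP (?m - i).
      part_weight c rho * green c lam (rho @ nths mu I))" for c
    using Cons.prems by (intro green_rec) simp_all
  have t: "degree (?t I rho) \<le> ?m - i + n_stat lam"
      "coeff (?t I rho) (?m - i + n_stat lam) = 2 ^ length rho / of_nat (z_stat rho) * 2 ^ (length lam - 1)"
    if "i \<in> {0..?m}" "I \<in> sub_index_sets mu i" "rho \<in> OP (?m - i)" for i I rho
    using coeff_mult_bounds[OF weight_poly_degree(1)[OF nu(3)[OF that]] F(2)[OF nu(1,2)[OF that]]]
      weight_poly_degree(2)[OF nu(3)[OF that]] F(3)[OF nu(1,2)[OF that]]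
    unfolding nu(4)[OF that] by simp_all
  have "green ?gc (k # lam) mu = to_fract P"
    unfolding rec P_def to_fract_sum to_fract_mult to_fract_weight_poly
  proof (intro sum.cong refl)
    fix i I rho assume "i \<in> {0..?m}" "I \<in> sub_index_sets mu i" "rho \<in> OP (?m - i)"
    from F(1)[OF nu(1,2)[OF this]]
    show "part_weight ?gc rho * green ?gc lam (rho @ nths mu I) = part_weight ?gc rho * to_fract (F (rho @ nths mu I))"
      by (rule arg_cong)
  qed
  moreover have "degree P \<le> n_stat (k # lam)"
    unfolding P_def n_stat_Cons
  proof (intro degree_sum_le finite_sub_index_sets finite_OP finite_atLeastAtMost)
    fix i I rho assume "i \<in> {0..?m}" "I \<in> sub_index_sets mu i" "rho \<in> OP (?m - i)"
    from t(1)[OF this] show "degree (?t I rho) \<le> n_stat lam + ?m" by linarith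
  qed
  moreover have "coeff P (n_stat (k # lam)) = 2 ^ (length (k # lam) - 1)"
  proof -
    have "coeff P (n_stat (k # lam)) = (\<Sum>i=0..?m. \<Sum>I\<in>sub_index_sets mu i. \<Sum>rho\<in>OP (?m - i). coeff (?t I rho) (?m + n_stat lam))"
      by (simp add: P_def n_stat_Cons coeff_sum add.commute)
    \<comment> \<open>A summand with \<open>i > 0\<close> has degree at most
      \<open>?m - i + n_stat lam\<close>, so only the empty subpartition reaches the top
      coefficient.\<close>
    also have "\<dots> = (\<Sum>i\<in>{0}. \<Sum>I\<in>sub_index_sets mu i. \<Sum>rho\<in>OP (?m - i). coeff (?t I rho) (?m + n_stat lam))"
    proof (rule sum.mono_neutral_right)
      show "\<forall>i\<in>{0..?m} - {0}. (\<Sum>I\<in>sub_index_sets mu i. \<Sum>rho\<in>OP (?m - i). coeff (?t I rho) (?m + n_stat lam)) = 0"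
      proof (intro ballI sum.neutral)
        fix i I rho assume i: "i \<in> {0..?m} - {0}" and I: "I \<in> sub_index_sets mu i" "rho \<in> OP (?m - i)"
        have "degree (?t I rho) \<le> ?m - i + n_stat lam" using i I by (intro t) auto
        thus "coeff (?t I rho) (?m + n_stat lam) = 0" using i by (intro coeff_eq_0) auto
      qed
    qed auto
    also have "\<dots> = (\<Sum>rho\<in>OP ?m. coeff (?t {} rho) (?m + n_stat lam))"
      using Cons.prems(1) by (simp add: sub_index_sets_0)
    also have "\<dots> = (\<Sum>rho\<in>OP ?m. 2 ^ length rho / of_nat (z_stat rho) * 2 ^ (length lam - 1))"
      using t(2)[of 0 "{}"] Cons.prems(1) by (intro sum.cong refl) (simp add: sub_index_sets_0)
    also have "\<dots> = (\<Sum>rho\<in>OP ?m. 2 ^ length rho / of_nat (z_stat rho)) * 2 ^ (length lam - 1)"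
      by (simp only: sum_distrib_right)
    also have "\<dots> = 2 ^ (length (k # lam) - 1)"
    \<comment> \<open>For empty \<open>lam\<close> only \<open>rho = []\<close> remains, with weight
      1; for nonempty \<open>lam\<close> the total is 2.\<close>
    proof (cases lam)
      case (Cons a lam')
      hence "?m > 0" using Cons.prems by auto
      thus ?thesis using Cons by (simp only: sum_leading_weights) simp
    qed simp
    finally show ?thesis .
  qed
  moreover have "const_ratfun (poly P 0) = green (\<lambda>n. - 1) (k # lam) mu"
    unfolding rec P_def poly_sum poly_mult const_ratfun_sum const_ratfun_mult
  proof (intro sum.cong refl)
    fix i I rho assume a: "i \<in> {0..?m}" "I \<in> sub_index_sets mu i" "rho \<in> OP (?m - i)"
    show "const_ratfun (poly (weight_poly rho) 0) * const_ratfun (poly (F (rho @ nths mu I)) 0) =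
       part_weight (\<lambda>n. - 1) rho * green (\<lambda>n. - 1) lam (rho @ nths mu I)"
      by (simp only: F(4)[OF nu(1,2)[OF a]] weight_poly_at_0[OF nu(3)[OF a]])
  qed
  ultimately show ?case by blast
qed

section \<open>Schur's Q-functions form a basis\<close>

text \<open>By \<open>lookup_part_exp_eq\<close> these constant terms recover all
  coefficients.\<close>

lemma gamma_eqI:
  assumes "\<And>mu. odd_parts mu \<Longrightarrow> const_term (half_deriv_part mu f) = const_term (half_deriv_part mu g)"
  shows "f = g"
proof (rule poly_mapping_eqI)
  fix m
  obtain xs where xs: "is_partition xs" "odd_parts xs" "m = part_exp xs" by (rule part_exp_surj)
  show "Poly_Mapping.lookup f m = Poly_Mapping.lookup g m"
    unfolding xs(3) lookup_part_exp_eq[OF xs(2)] assms[OF xs(2)] ..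
qed

section \<open>The Clifford relation\<close>

abbreviation schur_op :: "int \<Rightarrow> gamma \<Rightarrow> gamma" where
  "schur_op \<equiv> vertex_op (\<lambda>n. - 1)"

text \<open>The value is \<open>2 (-1)^m\<close> on \<open>m + n = 0\<close>; parity is used because
  \<open>m\<close> may be negative.\<close>

definition clifford_const :: "int \<Rightarrow> int \<Rightarrow> ratfun" where
  "clifford_const m n = (if m + n = 0 then if even m then 2 else - 2 else 0)"

text \<open>A shift by odd \<open>a\<close> flips the parity of the first index, so the two
  constants have opposite signs.\<close>

lemma clifford_const_shift:
  "odd a \<Longrightarrow> clifford_const (m - int a) n + clifford_const m (n - int a) = 0"
  "odd a \<Longrightarrow> clifford_const (m + int a) n + clifford_const m (n + int a) = 0"
  by (auto simp: clifford_const_def algebra_simps)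

text \<open>For opposite nonzero indices one term vanishes because \<open>creation\<close> is 0 at
  negative index, and the other is given by \<open>weight_sum_minus_1\<close>. At
  \<open>m = n = 0\<close> both terms are 1.\<close>

lemma const_term_clifford:
  "const_term (schur_op m (creation n)) + const_term (schur_op n (creation m)) = clifford_const m n"
proof -
  consider "m + n \<noteq> 0" | "m = 0" "n = 0" | "m = - n" "n > 0" | "n = - m" "m > 0" by linarith
  thus ?thesis
  proof cases
    case 1
    hence "m \<noteq> - n" "n \<noteq> - m" by auto
    thus ?thesis using 1 by (simp add: const_term_vertex_op_creation clifford_const_def)
  next
    case 2
    thus ?thesis by (simp add: vertex_op_1 const_term_creation clifford_const_def)
  qed (auto simp: const_term_vertex_op_creation clifford_const_def weight_sum_minus_1 minus_one_power_iff even_nat_iff)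
qed

text \<open>\<open>half_deriv a\<close> sends the anticommutator on the vacuum to those with
  \<open>m\<close> or \<open>n\<close> lowered by \<open>a\<close>. Their constants cancel for odd
  \<open>a\<close>, which matches the derivative of a scalar being 0;
  \<open>const_term_clifford\<close> starts the induction on \<open>mu\<close>.\<close>

lemma clifford_1:
  "schur_op m (creation n) + schur_op n (creation m) = scalar (clifford_const m n)"
proof (rule gamma_eqI)
  fix mu assume "odd_parts mu"
  thus "const_term (half_deriv_part mu (schur_op m (creation n) + schur_op n (creation m))) =
        const_term (half_deriv_part mu (scalar (clifford_const m n)))"
  proof (induction mu arbitrary: m n)
    case Nil
    show ?case by (simp add: lookup_add const_term_clifford lookup_scalar)
  next
    case (Cons a mu)
    hence a: "odd a" and mu: "odd_parts mu" by auto
    let ?C = "\<lambda>m n. schur_op m (creation n) + schur_op n (creation m)"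
    have h: "half_deriv_part (a # mu) f = half_deriv_part mu (half_deriv a f)" for f
      by (simp add: half_deriv_part_commute)
    have C: "half_deriv a (?C m n) = ?C (m - int a) n + ?C m (n - int a)"
      unfolding half_deriv_add half_deriv_vertex_op[OF a] half_deriv_creation[OF a] by (simp only: add_ac)
    have "const_term (half_deriv_part (a # mu) (?C m n)) =
        const_term (half_deriv_part mu (?C (m - int a) n)) + const_term (half_deriv_part mu (?C m (n - int a)))"
      unfolding h C half_deriv_part_add[of mu "?C (m - int a) n"] lookup_add ..
    also have "\<dots> = const_term (half_deriv_part mu (scalar (clifford_const (m - int a) n + clifford_const m (n - int a))))"
      unfolding Cons.IH[OF mu] scalar_add half_deriv_part_add[of mu "scalar (clifford_const (m - int a) n)"] lookup_add ..
    also have "\<dots> = const_term (half_deriv_part (a # mu) (scalar (clifford_const m n)))"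
      unfolding h clifford_const_shift(1)[OF a] using half_deriv_scalar_mult[of a "clifford_const m n" 1] by simp
    finally show ?case .
  qed
qed

text \<open>The relation spreads from the vacuum to \<open>\<Gamma>\<close> by
  \<open>gamma_induct\<close>. Moving \<open>p_a\<close> out produces the anticommutators with
  \<open>m\<close> or \<open>n\<close> raised by \<open>a\<close>, whose constants cancel.\<close>

lemma clifford:
  "schur_op m (schur_op n f) + schur_op n (schur_op m f) = scalar (clifford_const m n) * f"
proof (induction f arbitrary: m n rule: gamma_induct)
  case one
  show ?case by (simp only: vertex_op_1 clifford_1 mult_1_right)
next
  case (add f g)
  show ?case unfolding vertex_op_add distrib_left add.IH[symmetric] by (simp only: add_ac)
next
  case (scalar c f)
  show ?case unfolding vertex_op_scalar distrib_left[symmetric] scalar.IH by (rule mult.left_commute)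
next
  case (psum a f)
  have s: "schur_op k (psum a * g) = psum a * schur_op k g - schur_op (k + int a) g" for k g
    using vertex_op_psum[OF psum.hyps, of "\<lambda>n. - 1" k g] by (simp add: scalar_uminus)
  have d: "schur_op k (g - h) = schur_op k g - schur_op k h" for k g h
    using vertex_op_add[of _ k g "- h"] by (simp add: vertex_op_uminus)
  have "schur_op m (schur_op n (psum a * f)) + schur_op n (schur_op m (psum a * f)) =
     psum a * (schur_op m (schur_op n f) + schur_op n (schur_op m f)) -
     ((schur_op (m + int a) (schur_op n f) + schur_op n (schur_op (m + int a) f)) +
      (schur_op m (schur_op (n + int a) f) + schur_op (n + int a) (schur_op m f)))"
    unfolding s d by (simp add: distrib_left)
  also have "\<dots> = psum a * (scalar (clifford_const m n) * f) -
      scalar (clifford_const (m + int a) n + clifford_const m (n + int a)) * f"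
    unfolding psum.IH scalar_add distrib_right ..
  finally show ?case by (simp add: clifford_const_shift(2)[OF psum.hyps] mult.left_commute)
qed

lemma schur_op_anticommute:
  assumes "m + n \<noteq> 0"
  shows "schur_op m (schur_op n f) = - schur_op n (schur_op m f)"
  using clifford[of m n f] assms by (simp add: clifford_const_def add_eq_0_iff2)

lemma schur_op_square:
  assumes "k > 0"
  shows "schur_op k (schur_op k f) = 0"
proof -
  have "of_nat 2 * schur_op k (schur_op k f) = of_nat 2 * 0"
    using clifford[of k k f] assms by (simp add: clifford_const_def)
  thus ?thesis by (rule of_nat_mult_left_cancel[rotated]) simp
qed

section \<open>Strict partitions and dual functionals\<close>

lemma is_strict_Nil [simp]: "is_strict []"
  by (simp add: is_strict_def is_partition_def)

lemma is_strict_Cons: "is_strict (a # xs) \<longleftrightarrow> a > 0 \<and> (\<forall>x\<in>set xs. x < a) \<and> is_strict xs"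
  unfolding is_strict_def is_partition_def by (auto simp: le_less)

abbreviation schur_fun :: "partition \<Rightarrow> gamma" where
  "schur_fun \<equiv> vertex_fun (\<lambda>n. - 1)"

text \<open>\<open>Q_-a\<close> anticommutes past all modes of index below \<open>a\<close> and
  annihilates the vacuum.\<close>

lemma schur_op_neg_kills:
  assumes "\<forall>x\<in>set nu. x < a" "a > 0"
  shows "schur_op (- int a) (schur_fun nu) = 0"
  using assms
proof (induction nu)
  case Nil
  thus ?case by (simp add: vertex_op_1 creation_neg)
next
  case (Cons b nu)
  thus ?case by (simp add: schur_op_anticommute[of "- int a" "int b"] vertex_op_uminus)
qed

text \<open>The functional taking the constant term of \<open>\<dots> Q\<^bsub>-\<mu>\<^sub>2\<^esub> Q\<^bsub>-\<mu>\<^sub>1\<^esub> f\<close>; it vanishes on all \<open>Q\<^sub>\<nu>\<close> with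
  \<open>\<nu>\<close> strict except \<open>Q\<^sub>\<mu>\<close>.\<close>

fun dual_form :: "partition \<Rightarrow> gamma \<Rightarrow> ratfun" where
  "dual_form [] f = const_term f"
| "dual_form (a # mu) f = dual_form mu (schur_op (- int a) f)"

lemma dual_form_scalar: "dual_form mu (scalar c * f) = c * dual_form mu f"
  by (induction mu arbitrary: f) (simp_all add: vertex_op_scalar)

lemma dual_form_add: "dual_form mu (f + g) = dual_form mu f + dual_form mu g"
  by (induction mu arbitrary: f g) (simp_all add: vertex_op_add lookup_add)

lemma dual_form_0 [simp]: "dual_form mu 0 = 0"
  by (induction mu) simp_all

lemma dual_form_sum: "dual_form mu (sum f A) = (\<Sum>x\<in>A. dual_form mu (f x))"
  by (induction A rule: infinite_finite_induct) (simp_all add: dual_form_add)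

lemma dual_form_uminus: "dual_form mu (- f) = - dual_form mu f"
  using dual_form_scalar[of mu "- 1" f] by (simp add: scalar_uminus)

text \<open>\<open>Q_b\<close> moves outward past every \<open>Q_-a\<close> with
  \<open>a < b\<close>, and the image of a positive mode has no constant term.\<close>

lemma dual_form_schur_op:
  assumes "\<forall>x\<in>set mu. x < b" "b > 0"
  shows "dual_form mu (schur_op (int b) f) = 0"
  using assms
proof (induction mu arbitrary: f)
  case Nil
  thus ?case by (simp add: const_term_vertex_op)
next
  case (Cons a mu)
  thus ?case by (simp add: schur_op_anticommute[of "- int a" "int b"] dual_form_uminus)
qed

fun dual_norm :: "partition \<Rightarrow> ratfun" where
  "dual_norm [] = 1"
| "dual_norm (a # mu) = clifford_const (- int a) (int a) * dual_norm mu"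

lemma dual_norm_nonzero: "dual_norm mu \<noteq> 0"
  by (induction mu) (simp_all add: clifford_const_def)

text \<open>The first parts \<open>a\<close> and \<open>b\<close> are compared: for
  \<open>b < a\<close> the mode \<open>Q_-a\<close> kills \<open>Q_nu\<close>, for
  \<open>a < b\<close> the mode \<open>Q_b\<close> moves outward and leaves no constant term, and
  for \<open>a = b\<close> the Clifford relation removes both modes and leaves its constant.\<close>

lemma dual_form_schur_fun:
  assumes "is_strict mu" "is_strict nu"
  shows "dual_form mu (schur_fun nu) = (if mu = nu then dual_norm mu else 0)"
  using assms
proof (induction mu arbitrary: nu)
  case Nil
  thus ?case by (cases nu) (simp_all add: is_strict_Cons const_term_vertex_op)
next
  case (Cons a mu)
  hence a: "a > 0" "\<forall>x\<in>set mu. x < a" "is_strict mu" by (simp_all add: is_strict_Cons)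
  show ?case
  proof (cases nu)
    case Nil
    thus ?thesis using a by (simp add: vertex_op_1 creation_neg)
  next
    case nu: (Cons b nu')
    hence b: "b > 0" "\<forall>x\<in>set nu'. x < b" "is_strict nu'" using Cons.prems by (simp_all add: is_strict_Cons)
    consider "b < a" | "b = a" | "a < b" by linarith
    thus ?thesis
    proof cases
      case 1
      hence "\<forall>x\<in>set nu. x < a" using b nu by auto
      hence "dual_form (a # mu) (schur_fun nu) = 0"
        using a by (simp only: dual_form.simps schur_op_neg_kills dual_form_0)
      thus ?thesis using 1 nu by simp
    next
      case 2
      have "schur_op (- int a) (schur_fun nu) + schur_op (int a) (schur_op (- int a) (schur_fun nu')) =
          scalar (clifford_const (- int a) (int a)) * schur_fun nu'"
        unfolding nu 2 vertex_fun_simps by (rule clifford)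
      hence "schur_op (- int a) (schur_fun nu) = scalar (clifford_const (- int a) (int a)) * schur_fun nu'"
        using b 2 by (simp add: schur_op_neg_kills)
      thus ?thesis using 2 nu Cons.IH[OF a(3) b(3)] by (simp add: dual_form_scalar)
    next
      case 3
      hence "\<forall>x\<in>set (a # mu). x < b" using a by auto
      hence "dual_form (a # mu) (schur_fun nu) = 0"
        unfolding nu vertex_fun_simps using b by (intro dual_form_schur_op)
      thus ?thesis using 3 nu by simp
    qed
  qed
qed

section \<open>Schur's Q-functions span \<open>\<Gamma>\<close>\<close>

inductive_set schur_span :: "nat \<Rightarrow> gamma set" for b where
  zero: "0 \<in> schur_span b"
| step: "is_strict nu \<Longrightarrow> \<forall>x\<in>set nu. x < b \<Longrightarrow> f \<in> schur_span b \<Longrightarrow> scalar c * schur_fun nu + f \<in> schur_span b"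

lemma schur_span_add: "f \<in> schur_span b \<Longrightarrow> g \<in> schur_span b \<Longrightarrow> f + g \<in> schur_span b"
  by (induction rule: schur_span.induct) (auto simp: add.assoc intro: schur_span.step)

lemma schur_span_scalar: "f \<in> schur_span b \<Longrightarrow> scalar s * f \<in> schur_span b"
proof (induction rule: schur_span.induct)
  case (step nu f c)
  have "scalar s * (scalar c * schur_fun nu + f) = scalar (s * c) * schur_fun nu + scalar s * f"
    by (simp only: distrib_left scalar_mult mult.assoc)
  thus ?case using step by (auto intro: schur_span.step)
qed (simp add: schur_span.zero)

lemma schur_span_uminus: "f \<in> schur_span b \<Longrightarrow> - f \<in> schur_span b"
  using schur_span_scalar[of f b "- 1"] by (simp add: scalar_uminus)

lemma schur_span_mono: "f \<in> schur_span b \<Longrightarrow> b \<le> b' \<Longrightarrow> f \<in> schur_span b'"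
  by (induction rule: schur_span.induct) (auto intro!: schur_span.intros)

lemma schur_span_base: "is_strict nu \<Longrightarrow> \<forall>x\<in>set nu. x < b \<Longrightarrow> schur_fun nu \<in> schur_span b"
  using schur_span.step[of nu b 0 1] by (simp add: schur_span.zero)

text \<open>The bound in \<open>schur_span\<close> exists for this step: \<open>c\<close> may be
  prepended to a strict partition whose parts are all below \<open>c\<close>.\<close>

lemma schur_op_raises_span:
  assumes "f \<in> schur_span c" "0 < c" "c < b"
  shows "schur_op (int c) f \<in> schur_span b"
  using assms
proof (induction rule: schur_span.induct)
  case (step nu f s)
  have "is_strict (c # nu)" "\<forall>x\<in>set (c # nu). x < b"
    using step by (auto simp: is_strict_Cons)
  from schur_span.step[OF this, of "schur_op (int c) f" s] step show ?case
    by (simp add: vertex_op_add vertex_op_scalar)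
qed (simp add: schur_span.zero)

text \<open>Straightening. If \<open>k\<close> exceeds the first part \<open>c\<close>, it is
  prepended; if \<open>k = c\<close>, the square vanishes; if \<open>k < c\<close>, the Clifford
  relation swaps the two modes, and the induction hypothesis with bound \<open>c\<close> lets
  \<open>Q_c\<close> be prepended.\<close>

lemma schur_op_schur_fun_span:
  assumes "is_strict nu" "\<forall>x\<in>set nu. x < b" "k < int b"
  shows "schur_op k (schur_fun nu) \<in> schur_span b"
  using assms
proof (induction nu arbitrary: b k)
  case Nil
  have "schur_fun [nat k] \<in> schur_span b" if "k > 0"
    using that Nil by (intro schur_span_base) (auto simp: is_strict_Cons)
  moreover have "schur_fun [] \<in> schur_span b" by (intro schur_span_base) simp_all
  moreover have "schur_op k 1 = 0" if "k < 0" using that by (simp add: vertex_op_1 creation_neg)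
  ultimately show ?case
    by (cases k "0 :: int" rule: linorder_cases) (auto simp: schur_span.zero vertex_op_1)
next
  case (Cons c nu)
  hence c: "c > 0" "\<forall>x\<in>set nu. x < c" "is_strict nu" "c < b" by (simp_all add: is_strict_Cons)
  consider "k > int c" | "k = int c" | "k < int c" by linarith
  thus ?case
  proof cases
    case 1
    hence "is_strict (nat k # c # nu)" "\<forall>x\<in>set (nat k # c # nu). x < b"
      using Cons.prems c by (auto simp: is_strict_Cons)
    from schur_span_base[OF this] show ?thesis using 1 by simp
  next
    case 2
    thus ?thesis using c by (simp add: schur_op_square schur_span.zero)
  next
    case 3
    have "schur_op k (schur_fun nu) \<in> schur_span c" using Cons.IH[OF c(3,2) 3] .
    hence "schur_op (int c) (schur_op k (schur_fun nu)) \<in> schur_span b" using c by (intro schur_op_raises_span)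
    moreover have "schur_fun nu \<in> schur_span b" using Cons.prems c by (intro schur_span_base) auto
    moreover have "schur_op k (schur_fun (c # nu)) =
        scalar (clifford_const k (int c)) * schur_fun nu + - schur_op (int c) (schur_op k (schur_fun nu))"
      using clifford[of k "int c" "schur_fun nu"] by (simp add: eq_diff_eq)
    ultimately show ?thesis by (simp only: schur_span_add schur_span_scalar schur_span_uminus)
  qed
qed

definition in_schur_span :: "gamma \<Rightarrow> bool" where
  "in_schur_span f \<longleftrightarrow> (\<exists>b. f \<in> schur_span b)"

lemma in_schur_span_add: "in_schur_span f \<Longrightarrow> in_schur_span g \<Longrightarrow> in_schur_span (f + g)"
  unfolding in_schur_span_def by (meson schur_span_add schur_span_mono max.cobounded1 max.cobounded2)

lemma in_schur_span_scalar: "in_schur_span f \<Longrightarrow> in_schur_span (scalar c * f)"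
  unfolding in_schur_span_def using schur_span_scalar by blast

lemma in_schur_span_0: "in_schur_span 0"
  unfolding in_schur_span_def using schur_span.zero by blast

lemma in_schur_span_1: "in_schur_span 1"
  unfolding in_schur_span_def using schur_span_base[of "[]" 0] by (intro exI[of _ 0]) simp

lemma in_schur_span_sum: "(\<And>x. x \<in> A \<Longrightarrow> in_schur_span (f x)) \<Longrightarrow> in_schur_span (sum f A)"
  by (induction A rule: infinite_finite_induct) (auto intro: in_schur_span_0 in_schur_span_add)

lemma in_schur_span_op:
  assumes "in_schur_span f"
  shows "in_schur_span (schur_op k f)"
proof -
  obtain b where "f \<in> schur_span b" using assms by (auto simp: in_schur_span_def)
  thus ?thesis
  proof (induction rule: schur_span.induct)
    case (step nu f c)
    let ?b = "max b (nat (k + 1))"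
    have "schur_op k (schur_fun nu) \<in> schur_span ?b"
      using step by (intro schur_op_schur_fun_span) auto
    hence "in_schur_span (schur_op k (schur_fun nu))" by (auto simp: in_schur_span_def)
    thus ?case unfolding vertex_op_add vertex_op_scalar
      by (intro in_schur_span_add in_schur_span_scalar step.IH)
  qed (simp add: in_schur_span_0)
qed

lemma in_schur_span_creation: "in_schur_span (creation k)"
  using in_schur_span_op[OF in_schur_span_1] by (simp add: vertex_op_1)

text \<open>\<open>creation_coeff_rec\<close> is solved for \<open>p_a\<close>: it is a combination
  of \<open>creation_coeff a\<close> and products with smaller \<open>p_b\<close>, which lie in the
  span by induction.\<close>

lemma in_schur_span_psum:
  assumes "odd a" "in_schur_span f"
  shows "in_schur_span (psum a * f)"
  using assms
proof (induction a arbitrary: f rule: less_induct)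
  case (less a)
  let ?S = "{b. odd b \<and> b \<le> a}"
  have fin: "finite ?S" by (rule finite_subset[of _ "{..a}"]) auto
  have two: "2 = scalar 2" using scalar_of_nat[of 2] by simp
  have "of_nat a * creation_coeff a = (\<Sum>b\<in>?S. 2 * psum b * creation_coeff (a - b))" by (rule creation_coeff_rec)
  also have "\<dots> = 2 * psum a + (\<Sum>b\<in>?S - {a}. 2 * psum b * creation_coeff (a - b))"
    using less.prems fin by (subst sum.remove[of _ a]) auto
  finally have "2 * psum a = scalar (of_nat a) * creation_coeff a + scalar (- 1) * (\<Sum>b\<in>?S - {a}. 2 * psum b * creation_coeff (a - b))"
    by (simp add: scalar_of_nat scalar_uminus)
  hence "scalar (1 / 2) * (2 * psum a) = scalar (1 / 2) * (scalar (of_nat a) * creation_coeff a +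
     scalar (- 1) * (\<Sum>b\<in>?S - {a}. scalar 2 * (psum b * creation_coeff (a - b))))"
    by (simp only: two mult.assoc)
  moreover have "scalar (1 / 2) * (2 * psum a) = psum a"
    unfolding two mult.assoc[symmetric] scalar_mult[symmetric] by simp
  ultimately have psum_a: "psum a = scalar (1 / 2) * (scalar (of_nat a) * creation_coeff a +
     scalar (- 1) * (\<Sum>b\<in>?S - {a}. scalar 2 * (psum b * creation_coeff (a - b))))"
    by (simp only:)
  have cr: "in_schur_span (creation_coeff m)" for m
    using in_schur_span_creation[of "int m"] by (simp add: creation_def)
  have "in_schur_span (psum b * creation_coeff (a - b))" if "b \<in> ?S - {a}" for b
    using that by (intro less.IH cr) auto
  hence pa: "in_schur_span (psum a)"
    by (subst psum_a) (intro in_schur_span_scalar in_schur_span_add in_schur_span_sum cr)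
  \<comment> \<open>Multiplication by \<open>p_a\<close> moves past each mode \<open>k\<close> at
    the cost of a mode \<open>k + a\<close>, so the case of the vacuum suffices.\<close>
  have "in_schur_span (psum a * schur_fun nu)" for nu
  proof (induction nu)
    case Nil
    show ?case using pa by simp
  next
    case (Cons k nu)
    have "in_schur_span (schur_fun nu)"
      by (induction nu) (simp_all add: in_schur_span_1 in_schur_span_op)
    moreover have "psum a * schur_fun (k # nu) = schur_op (int k) (psum a * schur_fun nu) + schur_op (int k + int a) (schur_fun nu)"
      using vertex_op_psum[OF less.prems(1), of "\<lambda>n. - 1" "int k" "schur_fun nu"] by (simp add: scalar_uminus)
    ultimately show ?case using Cons by (simp only: in_schur_span_add in_schur_span_op)
  qed
  note nu = this
  obtain b where "f \<in> schur_span b" using less.prems by (auto simp: in_schur_span_def)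
  thus ?case
  proof (induction rule: schur_span.induct)
    case (step nu f c)
    have "psum a * (scalar c * schur_fun nu + f) = scalar c * (psum a * schur_fun nu) + psum a * f"
      by (simp only: distrib_left mult.left_commute)
    thus ?case using step nu by (simp only: in_schur_span_add in_schur_span_scalar)
  qed (simp add: in_schur_span_0)
qed

lemma in_schur_span: "in_schur_span f"
  by (induction f rule: gamma_induct)
    (simp_all add: in_schur_span_1 in_schur_span_add in_schur_span_scalar in_schur_span_psum)

section \<open>Uniqueness of the expansion and the Q-Kostka polynomials\<close>

definition schur_expansion :: "(partition \<Rightarrow> ratfun) \<Rightarrow> gamma \<Rightarrow> bool" where
  "schur_expansion L f \<longleftrightarrow> finite {xs. L xs \<noteq> 0} \<and> (\<forall>xs. L xs \<noteq> 0 \<longrightarrow> is_strict xs) \<and>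
     f = (\<Sum>xs\<in>{xs. L xs \<noteq> 0}. scalar (L xs) * schur_fun xs)"

lemma schur_expansion_exists: "\<exists>L. schur_expansion L f"
proof -
  obtain b where "f \<in> schur_span b" using in_schur_span by (auto simp: in_schur_span_def)
  thus ?thesis
  proof (induction rule: schur_span.induct)
    case zero
    show ?case by (rule exI[of _ "\<lambda>xs. 0"]) (simp add: schur_expansion_def)
  next
    case (step nu f c)
    then obtain L where L: "finite {xs. L xs \<noteq> 0}" "\<And>xs. L xs \<noteq> 0 \<Longrightarrow> is_strict xs"
      "f = (\<Sum>xs\<in>{xs. L xs \<noteq> 0}. scalar (L xs) * schur_fun xs)"
      by (auto simp: schur_expansion_def)
    \<comment> \<open>\<open>nu\<close> may already occur in the expansion of \<open>f\<close>, and
      its coefficient may become 0; both sums are therefore taken over \<open>?S\<close>.\<close>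
    let ?L = "L(nu := L nu + c)" and ?S = "insert nu {xs. L xs \<noteq> 0}"
    have sub: "{xs. ?L xs \<noteq> 0} \<subseteq> ?S" by auto
    have f: "f = (\<Sum>xs\<in>?S. scalar (L xs) * schur_fun xs)"
      unfolding L(3) using L(1) by (intro sum.mono_neutral_left) auto
    have "scalar c * schur_fun nu + f = (\<Sum>xs\<in>?S. (if xs = nu then scalar c * schur_fun nu else 0) + scalar (L xs) * schur_fun xs)"
      unfolding f sum.distrib using L(1) by (simp add: sum.delta)
    also have "\<dots> = (\<Sum>xs\<in>?S. scalar (?L xs) * schur_fun xs)"
      by (intro sum.cong refl) (auto simp: scalar_add distrib_right add.commute)
    also have "\<dots> = (\<Sum>xs\<in>{xs. ?L xs \<noteq> 0}. scalar (?L xs) * schur_fun xs)"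
      using L(1) sub by (intro sum.mono_neutral_right) auto
    finally have "schur_expansion ?L (scalar c * schur_fun nu + f)"
      unfolding schur_expansion_def using finite_subset[OF sub] L(1,2) step.hyps(1) by (auto split: if_splits)
    thus ?case by blast
  qed
qed

text \<open>The dual functional of \<open>nu\<close> annihilates every other term. As
  \<open>dual_norm\<close> is nonzero, the coefficients are determined by \<open>f\<close>.\<close>

lemma dual_form_expansion:
  assumes "schur_expansion L f" "is_strict nu"
  shows "dual_form nu f = L nu * dual_norm nu"
proof -
  have "dual_form nu f = (\<Sum>xs\<in>{xs. L xs \<noteq> 0}. L xs * dual_form nu (schur_fun xs))"
    using assms(1) by (simp only: schur_expansion_def dual_form_sum dual_form_scalar)
  also have "\<dots> = (\<Sum>xs\<in>{xs. L xs \<noteq> 0}. if xs = nu then L nu * dual_norm nu else 0)"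
    using assms by (intro sum.cong) (auto simp: schur_expansion_def dual_form_schur_fun)
  also have "\<dots> = L nu * dual_norm nu"
    using assms by (auto simp: schur_expansion_def sum.delta)
  finally show ?thesis .
qed

lemma schur_expansion_unique:
  assumes "schur_expansion L f" "schur_expansion L' f"
  shows "L = L'"
proof
  fix nu
  show "L nu = L' nu"
  proof (cases "is_strict nu")
    case True
    thus ?thesis using dual_form_expansion[OF assms(1) True] dual_form_expansion[OF assms(2) True] dual_norm_nonzero[of nu] by simp
  next
    case False
    hence "L nu = 0" "L' nu = 0" using assms unfolding schur_expansion_def by blast+
    thus ?thesis by simp
  qed
qed

text \<open>The defining condition of \<open>Q_Kostka\<close> is \<open>schur_expansion\<close>;
  existence and uniqueness make its definite description denote the expansion.\<close>

lemma Q_Kostka_expansion: "schur_expansion (\<lambda>nu. Q_Kostka nu lam) (G_fun lam)"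
proof -
  obtain L where L: "schur_expansion L (G_fun lam)" using schur_expansion_exists by blast
  have "(THE L. schur_expansion L (G_fun lam)) = L"
    by (rule the_equality, rule L) (rule schur_expansion_unique[OF _ L])
  hence "Q_Kostka nu lam = L nu" for nu
    unfolding Q_Kostka_def Q_fun_eq schur_expansion_def by simp
  thus ?thesis using L by simp
qed

section \<open>The theorem\<close>

text \<open>By \<open>green_poly\<close> the function is a polynomial in \<open>t\<close>, so
  \<open>ratfun_at\<close> evaluates it; at \<open>t = 0\<close> the factors \<open>t^n - 1\<close>
  become \<open>- 1\<close>.\<close>

lemma spin_Green_at_0:
  assumes "mu \<in> OP (sum_list lam)" "0 \<notin> set lam"
  shows "const_ratfun (ratfun_at (spin_Green lam mu) 0) = green (\<lambda>n. - 1) lam mu"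
proof -
  have "odd_parts mu" "sum_list mu = sum_list lam" using assms by (auto simp: OP_iff)
  from green_poly[OF this(1) assms(2) this(2)] obtain P where
    "spin_Green lam mu = to_fract P" "const_ratfun (poly P 0) = green (\<lambda>n. - 1) lam mu"
    using assms(1) by (auto simp: spin_Green_eq)
  thus ?thesis by (simp add: ratfun_at_to_fract)
qed

lemma SP_iff: "xs \<in> SP n \<longleftrightarrow> is_strict xs \<and> sum_list xs = n"
  by (simp add: SP_def)

lemma is_strict_0: "is_strict xs \<Longrightarrow> 0 \<notin> set xs"
  by (simp add: is_strict_def is_partition_def)

text \<open>The constant term of \<open>half_deriv_part mu\<close> is applied to the expansion of
  \<open>G_fun lam\<close>; by homogeneity a strict \<open>nu\<close> of weight other than
  \<open>n\<close> contributes nothing.\<close>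

lemma spin_Green_Kostka:
  assumes "lam \<in> SP n" "mu \<in> OP n"
  shows "spin_Green lam mu = (\<Sum>nu\<in>SP n. Q_Kostka nu lam * const_ratfun (ratfun_at (spin_Green nu mu) 0))"
proof -
  let ?L = "\<lambda>nu. Q_Kostka nu lam" and ?g = "\<lambda>nu. green (\<lambda>n. - 1) nu mu"
  have n: "sum_list lam = n" "odd_parts mu" "sum_list mu = n" using assms by (auto simp: SP_iff OP_iff)
  note L = Q_Kostka_expansion[of lam, unfolded schur_expansion_def]
  have "spin_Green lam mu = const_term (half_deriv_part mu (G_fun lam))"
    using assms n by (simp add: spin_Green_eq green_def G_fun_eq)
  also have "\<dots> = (\<Sum>nu\<in>{nu. ?L nu \<noteq> 0}. ?L nu * ?g nu)"
    by (subst conjunct2[OF conjunct2[OF L]])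
      (simp only: half_deriv_part_sum half_deriv_part_scalar lookup_sum lookup_scalar_mult green_def)
  also have "\<dots> = (\<Sum>nu\<in>{nu. ?L nu \<noteq> 0} \<union> SP n. ?L nu * ?g nu)"
    using L by (intro sum.mono_neutral_left) auto
  also have "\<dots> = (\<Sum>nu\<in>SP n. ?L nu * ?g nu)"
  proof (rule sum.mono_neutral_right)
    show "\<forall>nu\<in>({nu. ?L nu \<noteq> 0} \<union> SP n) - SP n. ?L nu * ?g nu = 0"
    proof
      fix nu assume "nu \<in> ({nu. ?L nu \<noteq> 0} \<union> SP n) - SP n"
      hence "sum_list mu \<noteq> sum_list nu" using L n by (auto simp: SP_iff)
      thus "?L nu * ?g nu = 0" using n by (simp add: green_homogeneous)
    qed
  qed (use L in auto)
  also have "\<dots> = (\<Sum>nu\<in>SP n. ?L nu * const_ratfun (ratfun_at (spin_Green nu mu) 0))"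
    using assms(2) by (intro sum.cong refl) (auto simp: SP_iff is_strict_0 spin_Green_at_0)
  finally show ?thesis .
qed

text \<open>The coefficient at the degree bound is a power of 2, hence nonzero, so the bound is
  attained.\<close>

lemma spin_Green_degree:
  assumes "mu \<in> OP (sum_list lam)" "0 \<notin> set lam"
  shows "\<exists>P. spin_Green lam mu = to_fract P \<and> degree P = n_stat lam \<and> lead_coeff P = 2 ^ (length lam - 1)"
proof -
  have "odd_parts mu" "sum_list mu = sum_list lam" using assms by (auto simp: OP_iff)
  from green_poly[OF this(1) assms(2) this(2)] obtain P where
    P: "green (\<lambda>n. tvar ^ n - 1) lam mu = to_fract P" "degree P \<le> n_stat lam" "coeff P (n_stat lam) = 2 ^ (length lam - 1)"
    by blast
  hence "degree P = n_stat lam" by (intro antisym le_degree) simp_all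
  thus ?thesis using P spin_Green_eq[OF assms(1)] by (intro exI[of _ P]) simp
qed

lemma clear_denominator: "z \<noteq> 0 \<Longrightarrow> a / z * r = inverse z * x \<Longrightarrow> a * r = x" for a :: "'a :: field"
  by (simp add: field_simps)

text \<open>The coefficient of \<open>p_mu\<close> is compared in Schur's formula and in the
  expansion of \<open>Q_fun lam\<close>; dividing by \<open>2^l(mu)\<close> changes the sign of
  \<open>l(mu)\<close> in the half exponent.\<close>

lemma spin_Green_character:
  assumes "mu \<in> OP (sum_list lam)" "0 \<notin> set lam" "irreducible_spin_character lam zeta"
  shows "ratfun_at (spin_Green lam mu) 0 =
    of_real (2 powr ((real (length lam) - real (length mu) + real (eps lam)) / 2)) * zeta mu"
proof -
  let ?r = "ratfun_at (spin_Green lam mu) 0" and ?m = "length mu"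
  let ?e = "(real (length lam) + real ?m + real (eps lam)) / 2"
  have mu: "is_partition mu" "odd_parts mu" "sum_list mu = sum_list lam" using assms(1) by (auto simp: OP_iff)
  have z: "(of_nat (z_stat mu) :: ratfun) \<noteq> 0" using z_stat_pos[OF odd_parts_0[OF mu(2)]] by simp
  have "Q_fun lam = (\<Sum>mu\<in>OP (sum_list lam). scalar (inverse (of_nat (z_stat mu)) *
           const_ratfun (of_real (2 powr ((real (length lam) + real (length mu) + real (eps lam)) / 2))
             * zeta mu)) * psum_part mu)"
    using assms(3) unfolding irreducible_spin_character_def by (rule conjunct2)
  hence "Poly_Mapping.lookup (Q_fun lam) (part_exp mu) =
      inverse (of_nat (z_stat mu)) * const_ratfun (of_real (2 powr ?e) * zeta mu)"
    using mu by (simp only: lookup_psum_part_sum if_True simp_thms)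
  hence "2 ^ ?m / of_nat (z_stat mu) * const_ratfun ?r =
      inverse (of_nat (z_stat mu)) * const_ratfun (of_real (2 powr ?e) * zeta mu)"
    by (simp only: Q_fun_eq lookup_vertex_fun[OF mu(2)] spin_Green_at_0[OF assms(1,2)])
  hence "2 ^ ?m * const_ratfun ?r = const_ratfun (of_real (2 powr ?e) * zeta mu)"
    by (rule clear_denominator[OF z])
  hence "const_ratfun (2 ^ ?m * ?r) = const_ratfun (of_real (2 powr ?e) * zeta mu)"
    by (simp only: const_ratfun_mult const_ratfun_power const_ratfun_2)
  hence r: "2 ^ ?m * ?r = of_real (2 powr ?e) * zeta mu" by simp
  have "2 powr ?e = 2 ^ ?m * 2 powr ((real (length lam) - real ?m + real (eps lam)) / 2)"
    by (simp add: powr_realpow[symmetric] powr_add[symmetric] field_simps)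
  hence "2 ^ ?m * ?r = 2 ^ ?m * (of_real (2 powr ((real (length lam) - real ?m + real (eps lam)) / 2)) * zeta mu)"
    using r by (simp add: mult.assoc)
  thus ?thesis by simp
qed

theorem theorem4p5:
  fixes n :: nat and lam mu :: partition
  assumes "n \<ge> 1" and "lam \<in> SP n" and "mu \<in> OP n"
  shows
    "spin_Green lam mu =
       (\<Sum>nu\<in>SP n. Q_Kostka nu lam * const_ratfun (ratfun_at (spin_Green nu mu) 0)) \<and>
     (\<exists>P. spin_Green lam mu = to_fract P \<and> degree P = n_stat lam \<and>
          lead_coeff P = 2 ^ (length lam - 1)) \<and>
     (\<forall>zeta. irreducible_spin_character lam zeta \<longrightarrow>
        ratfun_at (spin_Green lam mu) 0 =
          of_real (2 powr ((real (length lam) - real (length mu) + real (eps lam)) / 2)) * zeta mu) \<and>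
     spin_Green [n] mu = 1 \<and>
     (\<forall>k. n - k < k \<and> 1 \<le> n - k \<longrightarrow>
        spin_Green [k, n - k] mu =
          2 * (tvar - 1) / (tvar + 1) *
            (to_fract (regular_part k (D_poly mu))
              - const_ratfun (poly (regular_part k (D_poly mu)) (- 1)))
          + of_nat (D_num mu (n - k))) \<and>
     spin_Green lam mu =
       (\<Sum>i = 0..n - hd lam. \<Sum>I\<in>sub_index_sets mu i. \<Sum>rho\<in>OP (n - hd lam - i).
          (- 2) ^ length rho / z_stat_t rho *
          spin_Green (tl lam) (part_union (nths mu I) rho))"
proof -
  have lam: "0 \<notin> set lam" "sum_list lam = n" and mu: "odd_parts mu" "sum_list mu = n"
    using assms by (auto simp: SP_iff is_strict_0 OP_iff)
  \<comment> \<open>\<open>n \<ge> 1\<close> makes \<open>lam\<close> nonempty, so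
    \<open>hd lam\<close> is its first part.\<close>
  have "lam = hd lam # tl lam" using assms(1) lam by (cases lam) auto
  moreover from this have tl: "sum_list (tl lam) = n - hd lam" "hd lam + sum_list (tl lam) = n"
    using lam by (cases lam; simp)+
  ultimately have rec: "spin_Green lam mu =
       (\<Sum>i = 0..n - hd lam. \<Sum>I\<in>sub_index_sets mu i. \<Sum>rho\<in>OP (n - hd lam - i).
          (- 2) ^ length rho / z_stat_t rho * spin_Green (tl lam) (part_union (nths mu I) rho))"
    using spin_Green_rec[of mu "hd lam" "tl lam"] assms(3) by simp
  have row: "spin_Green [n] mu = 1"
    using spin_Green_eq[of mu "[n]"] green_one_row[OF mu] assms(3) by simp
  have rows: "spin_Green [k, n - k] mu =
          2 * (tvar - 1) / (tvar + 1) *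
            (to_fract (regular_part k (D_poly mu))
              - const_ratfun (poly (regular_part k (D_poly mu)) (- 1)))
          + of_nat (D_num mu (n - k))" if "1 \<le> n - k" for k
    using that assms(3) by (intro spin_Green_two_rows) simp
  have muo: "mu \<in> OP (sum_list lam)" using assms(3) lam by simp
  show ?thesis
    using spin_Green_Kostka[OF assms(2,3)] spin_Green_degree[OF muo lam(1)] spin_Green_character[OF muo lam(1)]
      row rows rec
    by blast
qed

end
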